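(* If a seed $\Sigma$ in $\mathcal F$ is coprime and acyclic, then $\mathcal L(\Sigma)=\mathcal U(\Sigma)$, i.e. its lower bound and its upper bound coincide.
   Context: Let $\mathbb P$ be a torsion-free abelian group, written multiplicatively, $\mathbb{ZP}$ its integer group ring, $n\ge 1$, and $\mathcal F$ a field isomorphic to the field of rational functions in $n$ independent variables over the fraction field of $\mathbb{ZP}$. A seed in $\mathcal F$ is a triple $\Sigma=(\mathbf x,\mathbf p,B)$ where: $\mathbf x=\{x_1,\dots,x_n\}$ (the cluster) is a transcendence basis of $\mathcal F$ over the fraction field of $\mathbb{ZP}$ (so that $\mathcal F$ is the field of rational functions in $\mathbf x$); $\mathbf p=(p_1^\pm,\dots,p_n^\pm)$ is a $2n$-tuple of elements of $\mathbb P$; $B=(b_{ij})$ is an $n\times n$ integer matrix (the exchange matrix) which is sign-skew-symmetric, i.e. for all $i,j$ either $b_{ij}=b_{ji}=0$ or $b_{ij}b_{ji}<0$. For $j\in\{1,\dots,n\}$ put $P_j=P_j(\mathbf x)=p_j^+\prod_{b_{ij}>0}x_i^{b_{ij}}+p_j^-\prod_{b_{ij}<0}x_i^{-b_{ij}}$, define $x_j'\in\mathcal F$ by the exchange relation $x_jx_j'=P_j$, and let $\mathbf x_j=(\mathbf x-\{x_j\})\cup\{x_j'\}$. The upper bound is $\mathcal U(\Sigma)=\mathbb{ZP}[\mathbf x^{\pm1}]\cap\mathbb{ZP}[\mathbf x_1^{\pm1}]\cap\dots\cap\mathbb{ZP}[\mathbf x_n^{\pm1}]\subset\mathcal F$,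 where $\mathbb{ZP}[\mathbf x^{\pm1}]$ denotes the ring of Laurent polynomials in the elements of $\mathbf x$. The lower bound is the subalgebra $\mathcal L(\Sigma)=\mathbb{ZP}[x_1,x_1',\dots,x_n,x_n']\subset\mathcal F$. The seed is coprime if $P_1,\dots,P_n$ are pairwise coprime in $\mathbb{ZP}[x_1,\dots,x_n]$, i.e. for $i\neq j$ any common divisor of $P_i$ and $P_j$ belongs to $\mathbb P$ up to sign. The seed is acyclic if the directed graph $\Gamma(\Sigma)$ with vertices $1,\dots,n$ and directed edges $(i,j)$ for $b_{ij}>0$ has no oriented cycles. *)

theory Defs
  imports "HOL-Library.Poly_Mapping" "HOL-Computational_Algebra.Polynomial"
begin

text \<open>
  The coefficient group is written additively, as a type of class \<open>ab_group_add\<close>. For such a type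
  \<open>'p\<close>, the type \<open>'p \<Rightarrow>\<^sub>0 int\<close> with the convolution product of \<open>Poly_Mapping\<close> is its
  integral group ring, in which the group element \<open>p\<close> is \<open>Poly_Mapping.single p 1\<close>.
\<close>

definition torsion_free :: "'p::ab_group_add itself \<Rightarrow> bool" where
  "torsion_free _ \<longleftrightarrow> (\<forall>(p::'p) k::nat. k > 0 \<longrightarrow> (\<Sum>i<k. p) = 0 \<longrightarrow> p = 0)"

definition inj_ring_hom :: "('r::ring_1 \<Rightarrow> 'f::ring_1) \<Rightarrow> bool" where
  "inj_ring_hom h \<longleftrightarrow> inj h \<and> h 1 = 1 \<and>
     (\<forall>a b. h (a + b) = h a + h b) \<and> (\<forall>a b. h (a * b) = h a * h b)"

subsection \<open>Subrings and subfields of the ambient field\<close>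

definition is_subring :: "'f::field set \<Rightarrow> bool" where
  "is_subring R \<longleftrightarrow> 0 \<in> R \<and> 1 \<in> R \<and> (\<forall>a\<in>R. - a \<in> R) \<and>
     (\<forall>a\<in>R. \<forall>b\<in>R. a + b \<in> R) \<and> (\<forall>a\<in>R. \<forall>b\<in>R. a * b \<in> R)"

definition is_subfield :: "'f::field set \<Rightarrow> bool" where
  "is_subfield K \<longleftrightarrow> is_subring K \<and> (\<forall>a\<in>K. inverse a \<in> K)"

definition ring_adjoin :: "'f::field set \<Rightarrow> 'f set \<Rightarrow> 'f set" where
  "ring_adjoin R S = is_subring hull (R \<union> S)"

definition field_adjoin :: "'f::field set \<Rightarrow> 'f set \<Rightarrow> 'f set" where
  "field_adjoin K S = is_subfield hull (K \<union> S)"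

text \<open>The fraction field of a domain embedded in a field by \<open>h\<close>, realized inside that field.\<close>

definition fraction_field :: "('r::ring_1 \<Rightarrow> 'f::field) \<Rightarrow> 'f set" where
  "fraction_field h = {h a / h b | a b. b \<noteq> 0}"

subsection \<open>Transcendence bases\<close>

text \<open>Multivariate polynomials in variables indexed by \<open>'n\<close> have type
  \<open>('n \<Rightarrow>\<^sub>0 nat) \<Rightarrow>\<^sub>0 'f\<close>, a monomial being given by its exponent vector.\<close>

definition eval_mpoly :: "(('n::finite \<Rightarrow>\<^sub>0 nat) \<Rightarrow>\<^sub>0 'f::field) \<Rightarrow> ('n \<Rightarrow> 'f) \<Rightarrow> 'f" where
  "eval_mpoly q x =
     (\<Sum>m\<in>Poly_Mapping.keys q. Poly_Mapping.lookup q m * (\<Prod>i\<in>UNIV. x i ^ Poly_Mapping.lookup m i))"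

definition alg_independent :: "'f::field set \<Rightarrow> ('n::finite \<Rightarrow> 'f) \<Rightarrow> bool" where
  "alg_independent K x \<longleftrightarrow>
     (\<forall>q. (\<forall>m. Poly_Mapping.lookup q m \<in> K) \<longrightarrow> eval_mpoly q x = 0 \<longrightarrow> q = 0)"

definition algebraic_over :: "'f::field set \<Rightarrow> 'f \<Rightarrow> bool" where
  "algebraic_over K a \<longleftrightarrow> (\<exists>q. q \<noteq> 0 \<and> (\<forall>i. coeff q i \<in> K) \<and> poly q a = 0)"

definition transcendence_basis :: "'f::field set \<Rightarrow> ('n::finite \<Rightarrow> 'f) \<Rightarrow> bool" where
  "transcendence_basis K x \<longleftrightarrow>
     alg_independent K x \<and> (\<forall>a. algebraic_over (field_adjoin K (range x)) a)"

text \<open>\<open>\<iota>\<close> makes the type \<open>'f\<close> into a field of rational functions, in independent variables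
  indexed by \<open>'n\<close>, over the fraction field of the group ring of \<open>'p\<close>.\<close>

definition ambient_field ::
  "'n::finite itself \<Rightarrow> (('p::ab_group_add \<Rightarrow>\<^sub>0 int) \<Rightarrow> 'f::field) \<Rightarrow> bool" where
  "ambient_field _ \<iota> \<longleftrightarrow> inj_ring_hom \<iota> \<and>
     (\<exists>y :: 'n \<Rightarrow> 'f. alg_independent (fraction_field \<iota>) y \<and>
        field_adjoin (fraction_field \<iota>) (range y) = UNIV)"

subsection \<open>Seeds\<close>

record ('n, 'p, 'f) seed =
  cluster :: "'n \<Rightarrow> 'f"
  coeff_pos :: "'n \<Rightarrow> 'p"
  coeff_neg :: "'n \<Rightarrow> 'p"
  exchange_matrix :: "'n \<Rightarrow> 'n \<Rightarrow> int"

definition sign_skew_symmetric :: "('n \<Rightarrow> 'n \<Rightarrow> int) \<Rightarrow> bool" where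
  "sign_skew_symmetric B \<longleftrightarrow> (\<forall>i j. (B i j = 0 \<and> B j i = 0) \<or> B i j * B j i < 0)"

definition is_seed ::
  "(('p::ab_group_add \<Rightarrow>\<^sub>0 int) \<Rightarrow> 'f::field) \<Rightarrow> ('n::finite, 'p, 'f) seed \<Rightarrow> bool" where
  "is_seed \<iota> \<Sigma> \<longleftrightarrow>
     transcendence_basis (fraction_field \<iota>) (cluster \<Sigma>) \<and>
     field_adjoin (fraction_field \<iota>) (range (cluster \<Sigma>)) = UNIV \<and>
     sign_skew_symmetric (exchange_matrix \<Sigma>)"

definition exchange_poly ::
  "(('p::ab_group_add \<Rightarrow>\<^sub>0 int) \<Rightarrow> 'f::field) \<Rightarrow> ('n::finite, 'p, 'f) seed \<Rightarrow> 'n \<Rightarrow> 'f" where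
  "exchange_poly \<iota> \<Sigma> j =
     \<iota> (Poly_Mapping.single (coeff_pos \<Sigma> j) 1) *
       (\<Prod>i | exchange_matrix \<Sigma> i j > 0. cluster \<Sigma> i ^ nat (exchange_matrix \<Sigma> i j)) +
     \<iota> (Poly_Mapping.single (coeff_neg \<Sigma> j) 1) *
       (\<Prod>i | exchange_matrix \<Sigma> i j < 0. cluster \<Sigma> i ^ nat (- exchange_matrix \<Sigma> i j))"

text \<open>The element determined by the exchange relation; see \<open>exchange_relation\<close> below.\<close>

definition new_var ::
  "(('p::ab_group_add \<Rightarrow>\<^sub>0 int) \<Rightarrow> 'f::field) \<Rightarrow> ('n::finite, 'p, 'f) seed \<Rightarrow> 'n \<Rightarrow> 'f" where
  "new_var \<iota> \<Sigma> j = exchange_poly \<iota> \<Sigma> j / cluster \<Sigma> j"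

definition adjacent_cluster ::
  "(('p::ab_group_add \<Rightarrow>\<^sub>0 int) \<Rightarrow> 'f::field) \<Rightarrow> ('n::finite, 'p, 'f) seed \<Rightarrow> 'n \<Rightarrow> 'n \<Rightarrow> 'f" where
  "adjacent_cluster \<iota> \<Sigma> j = (cluster \<Sigma>)(j := new_var \<iota> \<Sigma> j)"

definition laurent_ring ::
  "(('p::ab_group_add \<Rightarrow>\<^sub>0 int) \<Rightarrow> 'f::field) \<Rightarrow> ('n \<Rightarrow> 'f) \<Rightarrow> 'f set" where
  "laurent_ring \<iota> y = ring_adjoin (range \<iota>) (range y \<union> range (\<lambda>i. inverse (y i)))"

definition upper_bound ::
  "(('p::ab_group_add \<Rightarrow>\<^sub>0 int) \<Rightarrow> 'f::field) \<Rightarrow> ('n::finite, 'p, 'f) seed \<Rightarrow> 'f set" where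
  "upper_bound \<iota> \<Sigma> =
     laurent_ring \<iota> (cluster \<Sigma>) \<inter> (\<Inter>j. laurent_ring \<iota> (adjacent_cluster \<iota> \<Sigma> j))"

definition lower_bound ::
  "(('p::ab_group_add \<Rightarrow>\<^sub>0 int) \<Rightarrow> 'f::field) \<Rightarrow> ('n::finite, 'p, 'f) seed \<Rightarrow> 'f set" where
  "lower_bound \<iota> \<Sigma> = ring_adjoin (range \<iota>) (range (cluster \<Sigma>) \<union> range (new_var \<iota> \<Sigma>))"

definition dvd_in :: "'f::field set \<Rightarrow> 'f \<Rightarrow> 'f \<Rightarrow> bool" where
  "dvd_in R d a \<longleftrightarrow> d \<in> R \<and> (\<exists>q\<in>R. a = d * q)"

definition coprime_seed ::
  "(('p::ab_group_add \<Rightarrow>\<^sub>0 int) \<Rightarrow> 'f::field) \<Rightarrow> ('n::finite, 'p, 'f) seed \<Rightarrow> bool" where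
  "coprime_seed \<iota> \<Sigma> \<longleftrightarrow>
     (let R = ring_adjoin (range \<iota>) (range (cluster \<Sigma>)) in
      \<forall>i j. i \<noteq> j \<longrightarrow>
        (\<forall>d. dvd_in R d (exchange_poly \<iota> \<Sigma> i) \<longrightarrow> dvd_in R d (exchange_poly \<iota> \<Sigma> j) \<longrightarrow>
           (\<exists>p. d = \<iota> (Poly_Mapping.single p 1) \<or> d = - \<iota> (Poly_Mapping.single p 1))))"

definition acyclic_seed :: "('n, 'p, 'f) seed \<Rightarrow> bool" where
  "acyclic_seed \<Sigma> \<longleftrightarrow> acyclic {(i, j). exchange_matrix \<Sigma> i j > 0}"

lemma cluster_nonzero:
  fixes \<iota> :: "('p::ab_group_add \<Rightarrow>\<^sub>0 int) \<Rightarrow> 'f::field"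
    and \<Sigma> :: "('n::finite, 'p, 'f) seed"
  assumes "inj_ring_hom \<iota>" "is_seed \<iota> \<Sigma>"
  shows "cluster \<Sigma> j \<noteq> 0"
proof
  assume zero: "cluster \<Sigma> j = 0"
  let ?m = "Poly_Mapping.single j (1::nat)"
  let ?q = "Poly_Mapping.single ?m (1::'f)"
  have hom: "\<iota> 1 = 1" "\<iota> (0 + 0) = \<iota> 0 + \<iota> 0"
    using assms(1) unfolding inj_ring_hom_def by blast+
  have "\<iota> 0 = 0"
    using hom(2) by (metis add_0 add_cancel_left_left)
  then have "\<iota> 0 / \<iota> 1 = 0" "\<iota> 1 / \<iota> 1 = 1"
    using hom(1) by auto
  then have K: "0 \<in> fraction_field \<iota>" "1 \<in> fraction_field \<iota>"
    unfolding fraction_field_def by (metis (mono_tags, lifting) mem_Collect_eq one_neq_zero)+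
  have "(\<Prod>i\<in>UNIV. cluster \<Sigma> i ^ Poly_Mapping.lookup ?m i) = 0"
    using zero by (intro prod_zero) (auto intro!: bexI[of _ j])
  then have "eval_mpoly ?q (cluster \<Sigma>) = 0"
    by (simp add: eval_mpoly_def)
  moreover have "\<forall>m. Poly_Mapping.lookup ?q m \<in> fraction_field \<iota>"
    using K by (simp add: lookup_single when_def)
  ultimately have "?q = 0"
    using assms(2) unfolding is_seed_def transcendence_basis_def alg_independent_def by blast
  then show False
    by (metis lookup_single_eq lookup_zero one_neq_zero)
qed

lemma exchange_relation:
  assumes "inj_ring_hom \<iota>" "is_seed \<iota> \<Sigma>"
  shows "cluster \<Sigma> j * new_var \<iota> \<Sigma> j = exchange_poly \<iota> \<Sigma> j"
  using cluster_nonzero[OF assms] by (simp add: new_var_def)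

end

theory Submission
  imports Defs "HOL-Library.Function_Algebras" "HOL-Library.Product_Plus"
begin

text \<open>
  The proof freezes cluster variables until no edges are left. For a set \<open>S\<close> of indices, declare the
  variables outside \<open>S\<close> frozen, that is, invertible, and let \<open>L S\<close> be the resulting lower bound,
  generated by all \<open>x i\<close>, the \<open>x' j\<close> with \<open>j \<in> S\<close> and the inverses of the \<open>x k\<close> with \<open>k \<notin> S\<close>. By
  induction on \<open>S\<close>, the ring \<open>L S\<close> contains every element that is Laurent in the given cluster and in
  the clusters adjacent to it at the elements of \<open>S\<close> (\<open>upper_subset_partial_lower\<close>). If \<open>S\<close> contains an
  edge, acyclicity provides a source \<open>i\<close> of the graph on \<open>S\<close> with an edge to some \<open>j\<close>. One term of
  \<open>P i\<close> is then a unit of \<open>L S\<close> and the other is divisible by \<open>x j\<close>, so the relation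
  \<open>x i * x' i = P i\<close> shows that \<open>x i\<close> and \<open>x j\<close> generate the unit ideal (\<open>comaximal_at_source\<close>). By
  induction the element lies in \<open>L (S - {i})\<close> and in \<open>L (S - {j})\<close>, which are contained in the
  localizations of \<open>L S\<close> at \<open>x i\<close> and at \<open>x j\<close>, and two comaximal elements allow denominators to be
  cleared (\<open>mem_subring_if_comaximal_multiples\<close>).

  If \<open>S\<close> contains no edge, each \<open>P j\<close> with \<open>j \<in> S\<close> involves frozen variables only, and the question is
  one of divisibility of coefficients: being Laurent in the cluster adjacent at \<open>j\<close> means that the
  coefficient of degree \<open>- r\<close> in \<open>x j\<close> is divisible by \<open>P j ^ r\<close>, and pairwise coprimality turns
  divisibility by several such powers into divisibility by their product
  (\<open>isolated_upper_subset_lower\<close>).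

  The group need not be finitely generated, so that Laurent polynomials need not have unique
  factorization. What is used instead is that the \<open>P j\<close> are binomials in the group ring of the
  torsion-free group of all Laurent monomials, in which they are associated to \<open>1 + X^t\<close>. For two
  such binomials either the second cancels modulo the first or both exponents are odd multiples
  of a common \<open>s\<close> (\<open>binomials_coprime_or_odd_multiples\<close>). In the second case \<open>1 + X^s\<close> is a common
  divisor, which coprimality of the seed forbids (\<open>nonzerodiv_mod_P\<close>).
\<close>

section \<open>Integer multiples in an abelian group\<close>

definition zmul :: "int \<Rightarrow> 'g::ab_group_add \<Rightarrow> 'g" where
  "zmul k g = (if 0 \<le> k then \<Sum>i<nat k. g else - (\<Sum>i<nat (- k). g))"

lemma zmul_0 [simp]: "zmul 0 g = 0"
  by (simp add: zmul_def)

lemma zmul_succ: "zmul (k + 1) g = zmul k g + g"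
proof (cases "0 \<le> k")
  case True
  then have "nat (k + 1) = Suc (nat k)" by simp
  with True show ?thesis by (simp add: zmul_def)
next
  case False
  then have "nat (- k) = Suc (nat (- (k + 1)))" by simp
  with False show ?thesis by (cases "k = -1") (simp_all add: zmul_def)
qed

lemma zmul_1 [simp]: "zmul 1 g = g"
  using zmul_succ[of 0 g] by simp

lemma zmul_add: "zmul (k + l) g = zmul k g + zmul l g"
proof (induction l rule: int_induct[of _ 0])
  case (step1 l)
  then show ?case using zmul_succ[of "k + l" g] zmul_succ[of l g] by (simp add: algebra_simps)
next
  case (step2 l)
  then show ?case using zmul_succ[of "k + (l - 1)" g] zmul_succ[of "l - 1" g]
    by (simp add: algebra_simps)
qed simp

lemma zmul_minus: "zmul (- k) g = - zmul k g"
  using zmul_add[of "- k" k g] by (simp add: eq_neg_iff_add_eq_0)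

lemma zmul_diff: "zmul (k - l) g = zmul k g - zmul l g"
  using zmul_add[of k "- l" g] by (simp add: zmul_minus)

lemma zmul_mult: "zmul (k * l) g = zmul k (zmul l g)"
proof (induction k rule: int_induct[of _ 0])
  case (step1 k)
  then show ?case by (simp add: zmul_add distrib_right)
next
  case (step2 k)
  then show ?case by (simp add: zmul_diff left_diff_distrib)
qed simp

lemma zmul_add_right: "zmul k (g + h) = zmul k g + zmul k h"
proof (induction k rule: int_induct[of _ 0])
  case (step1 k)
  then show ?case by (simp add: zmul_add)
next
  case (step2 k)
  then show ?case by (simp add: zmul_diff)
qed simp

lemma zmul_zero_right [simp]: "zmul k 0 = 0"
  using zmul_add_right[of k 0 0] by simp

lemma zmul_minus_right: "zmul k (- g) = - zmul k g"
  using zmul_add_right[of k g "- g"] by (simp add: eq_neg_iff_add_eq_0 add.commute)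

lemma zmul_eq_0_iff:
  fixes g :: "'g::ab_group_add"
  assumes "torsion_free TYPE('g)"
  shows "zmul k g = 0 \<longleftrightarrow> k = 0 \<or> g = 0"
proof
  assume k: "zmul k g = 0"
  show "k = 0 \<or> g = 0"
  proof (rule disjCI)
    assume "g \<noteq> 0"
    then have *: "(\<Sum>i<n. g) \<noteq> 0" if "n > 0" for n :: nat
      using assms that unfolding torsion_free_def by blast
    show "k = 0"
      using k *[of "nat k"] *[of "nat (- k)"] by (cases k "0 :: int" rule: linorder_cases) (auto simp: zmul_def)
  qed
qed auto

text \<open>Divide a relation by the greatest common divisor of its coefficients, which torsion-freeness
  permits; a Bezout combination of \<open>t\<close> and \<open>t'\<close> then generates both.\<close>

lemma commensurable_imp_common_generator:
  fixes t t' :: "'g::ab_group_add"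
  assumes tf: "torsion_free TYPE('g)" and a: "a \<noteq> 0" and rel: "zmul a t = zmul b t'"
  obtains k l s where "coprime k l" "t = zmul l s" "t' = zmul k s"
proof -
  define d where "d = gcd a b"
  have d: "d \<noteq> 0" using a by (simp add: d_def)
  obtain k l where kl: "a = d * k" "b = d * l" "coprime k l"
    using gcd_coprime_exists[of a b] d unfolding d_def by (metis mult.commute)
  have "zmul d (zmul k t - zmul l t') = 0"
    using rel unfolding kl zmul_mult diff_conv_add_uminus zmul_add_right zmul_minus_right by simp
  then have rel': "zmul k t = zmul l t'"
    using zmul_eq_0_iff[OF tf] d by simp
  obtain u v where uv: "u * k + v * l = 1"
    using bezout_int[of k l] kl(3) by auto
  let ?s = "zmul v t + zmul u t'"
  have "zmul l ?s = zmul (v * l) t + zmul (u * l) t'"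
    by (simp add: zmul_add_right flip: zmul_mult) (simp add: mult.commute)
  also have "zmul (u * l) t' = zmul (u * k) t"
    using rel' by (simp add: zmul_mult)
  finally have "zmul l ?s = zmul (u * k + v * l) t" by (simp add: zmul_add add.commute)
  then have l: "t = zmul l ?s" using uv by simp
  have "zmul k ?s = zmul (v * k) t + zmul (u * k) t'"
    by (simp add: zmul_add_right flip: zmul_mult) (simp add: mult.commute)
  also have "zmul (v * k) t = zmul (v * l) t'"
    using rel' by (simp add: zmul_mult)
  finally have "zmul k ?s = zmul (u * k + v * l) t'" by (simp add: zmul_add add.commute)
  then have k: "t' = zmul k ?s" using uv by simp
  show ?thesis by (rule that[OF kl(3) l k])
qed

section \<open>Cancellation modulo an element of a commutative ring\<close>

text \<open>For \<open>a = 0\<close> this says that \<open>b\<close> is not a zero divisor.\<close>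

definition nonzerodiv_mod :: "'a::comm_ring_1 \<Rightarrow> 'a \<Rightarrow> bool" where
  "nonzerodiv_mod a b \<longleftrightarrow> (\<forall>c. a dvd b * c \<longrightarrow> a dvd c)"

lemma nonzerodiv_modD: "nonzerodiv_mod a b \<Longrightarrow> a dvd b * c \<Longrightarrow> a dvd c"
  unfolding nonzerodiv_mod_def by blast

lemma nonzerodiv_mod_mult: "nonzerodiv_mod a b \<Longrightarrow> nonzerodiv_mod a c \<Longrightarrow> nonzerodiv_mod a (b * c)"
  unfolding nonzerodiv_mod_def mult.assoc by blast

lemma nonzerodiv_mod_one: "nonzerodiv_mod a 1"
  unfolding nonzerodiv_mod_def by simp

lemma nonzerodiv_mod_power: "nonzerodiv_mod a b \<Longrightarrow> nonzerodiv_mod a (b ^ n)"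
  by (induction n) (simp_all add: nonzerodiv_mod_mult nonzerodiv_mod_one)

lemma nonzerodiv_mod_prod:
  "(\<And>i. i \<in> I \<Longrightarrow> nonzerodiv_mod a (f i)) \<Longrightarrow> nonzerodiv_mod a (prod f I)"
  by (induction I rule: infinite_finite_induct) (simp_all add: nonzerodiv_mod_mult nonzerodiv_mod_one)

lemma nonzerodiv_cancel:
  assumes "nonzerodiv_mod 0 a" "a * b = a * c"
  shows "b = (c :: 'a::comm_ring_1)"
proof -
  have "a * (b - c) = 0" using assms(2) by (simp add: right_diff_distrib)
  then have "0 dvd b - c" using nonzerodiv_modD[OF assms(1), of "b - c"] by simp
  then show ?thesis by simp
qed

lemma nonzerodiv_dvd_cancel:
  assumes "nonzerodiv_mod 0 a" "a * b dvd a * c"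
  shows "b dvd (c :: 'a::comm_ring_1)"
proof -
  obtain q where "a * c = a * (b * q)" using assms(2) by (auto simp: dvd_def mult.assoc)
  then have "c = b * q" by (rule nonzerodiv_cancel[OF assms(1)])
  then show ?thesis by simp
qed

lemma nonzerodiv_mod_sym:
  assumes "nonzerodiv_mod 0 a" and ab: "nonzerodiv_mod a b"
  shows "nonzerodiv_mod b a"
  unfolding nonzerodiv_mod_def
proof (intro allI impI)
  fix c assume "b dvd a * c"
  then obtain d where d: "a * c = b * d" ..
  then have "a dvd d" using nonzerodiv_modD[OF ab, of d] by (metis dvd_triv_left)
  then obtain e where "d = a * e" ..
  with d have "a * c = a * (b * e)" by (simp add: algebra_simps)
  then have "c = b * e" by (rule nonzerodiv_cancel[OF assms(1)])
  then show "b dvd c" by simp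
qed

lemma nonzerodiv_mod_powers:
  assumes "nonzerodiv_mod 0 a" "nonzerodiv_mod 0 b" "nonzerodiv_mod a b"
  shows "nonzerodiv_mod (a ^ m) (b ^ n)"
proof -
  have "nonzerodiv_mod b (a ^ m)"
    by (rule nonzerodiv_mod_power[OF nonzerodiv_mod_sym[OF assms(1,3)]])
  then have "nonzerodiv_mod (a ^ m) b"
    by (rule nonzerodiv_mod_sym[OF assms(2)])
  then show ?thesis by (rule nonzerodiv_mod_power)
qed

lemma prod_dvd_if_pairwise_nonzerodiv_mod:
  assumes "finite I" "\<And>i j. i \<in> I \<Longrightarrow> j \<in> I \<Longrightarrow> i \<noteq> j \<Longrightarrow> nonzerodiv_mod (f i) (f j)"
    and "\<And>i. i \<in> I \<Longrightarrow> f i dvd c"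
  shows "prod f I dvd c"
  using assms
proof (induction I rule: finite_induct)
  case (insert i I)
  then have "prod f I dvd c" by blast
  then obtain d where d: "c = prod f I * d" ..
  have "nonzerodiv_mod (f i) (prod f I)"
    using insert by (intro nonzerodiv_mod_prod) auto
  moreover have "f i dvd prod f I * d" using insert.prems(2)[of i] d by simp
  ultimately have "f i dvd d" by (rule nonzerodiv_modD)
  then show ?case using insert.hyps d by (auto simp: mult.commute intro: mult_dvd_mono)
qed simp

section \<open>Restricting an element of a group ring to a set of exponents\<close>

abbreviation monom_of :: "'g \<Rightarrow> 'g::ab_group_add \<Rightarrow>\<^sub>0 int" where
  "monom_of g \<equiv> Poly_Mapping.single g 1"

definition part :: "'g set \<Rightarrow> ('g \<Rightarrow>\<^sub>0 int) \<Rightarrow> ('g::ab_group_add \<Rightarrow>\<^sub>0 int)" where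
  "part C f = Poly_Mapping.mapp (\<lambda>g v. if g \<in> C then v else 0) f"

lemma lookup_part: "Poly_Mapping.lookup (part C f) g = (if g \<in> C then Poly_Mapping.lookup f g else 0)"
  by (simp add: part_def lookup_mapp when_def in_keys_iff)

lemma keys_part: "Poly_Mapping.keys (part C f) = Poly_Mapping.keys f \<inter> C"
  by (auto simp: in_keys_iff lookup_part split: if_splits)

lemma part_zero [simp]: "part C 0 = 0"
  by (rule poly_mapping_eqI) (simp add: lookup_part)

lemma part_add: "part C (f + g) = part C f + part C g"
  by (rule poly_mapping_eqI) (simp add: lookup_part lookup_add)

lemma part_diff: "part C (f - g) = part C f - part C g"
  by (rule poly_mapping_eqI) (simp add: lookup_part lookup_minus)

lemma part_sum: "part C (\<Sum>i\<in>I. f i) = (\<Sum>i\<in>I. part C (f i))"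
  by (induction I rule: infinite_finite_induct) (simp_all add: part_add)

lemma part_monom_of: "part C (monom_of g) = (if g \<in> C then monom_of g else 0)"
  by (rule poly_mapping_eqI) (simp add: lookup_part lookup_single when_def)

lemma part_idem: "Poly_Mapping.keys f \<subseteq> C \<Longrightarrow> part C f = f"
  by (rule poly_mapping_eqI) (auto simp: lookup_part in_keys_iff)

lemma part_eq_0: "Poly_Mapping.keys f \<inter> C = {} \<Longrightarrow> part C f = 0"
  by (rule poly_mapping_eqI) (auto simp: lookup_part in_keys_iff)

lemma part_mult:
  assumes "\<And>g h. g \<in> Poly_Mapping.keys a \<Longrightarrow> g + h \<in> C \<longleftrightarrow> h \<in> C"
  shows "part C (a * f) = a * part C f"
proof (rule poly_mapping_eqI)
  fix k
  let ?l = "Poly_Mapping.lookup"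
  have "(if k \<in> C then ?l a l * (\<Sum>q. ?l f q when k = l + q) else 0)
      = ?l a l * (\<Sum>q. (if q \<in> C then ?l f q else 0) when k = l + q)" for l
  proof (cases "?l a l = 0")
    case False
    then have "l + q \<in> C \<longleftrightarrow> q \<in> C" for q using assms[of l q] by (simp add: in_keys_iff)
    then have "((if q \<in> C then ?l f q else 0) when k = l + q)
        = (if k \<in> C then (?l f q when k = l + q) else 0)" for q
      by (auto simp: when_def)
    then show ?thesis by simp
  qed simp
  then have "(\<Sum>l. if k \<in> C then ?l a l * (\<Sum>q. ?l f q when k = l + q) else 0)
      = (\<Sum>l. ?l a l * (\<Sum>q. (if q \<in> C then ?l f q else 0) when k = l + q))" by simp
  then show "?l (part C (a * f)) k = ?l (a * part C f) k"
    by (cases "k \<in> C") (simp_all add: lookup_part lookup_mult)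
qed

lemma part_commutes_power:
  assumes "\<And>f. part C (a * f) = a * part C f"
  shows "part C (a ^ n * f) = a ^ n * part C f"
  by (induction n arbitrary: f) (simp_all add: assms mult.assoc)

lemma part_commutes_prod:
  assumes "\<And>i f. i \<in> I \<Longrightarrow> part C (a i * f) = a i * part C f"
  shows "part C (prod a I * f) = prod a I * part C f"
  using assms by (induction I arbitrary: f rule: infinite_finite_induct) (simp_all add: mult.assoc)

lemma sum_parts: "(\<Sum>v\<in>\<phi> ` Poly_Mapping.keys f. part {g. \<phi> g = v} f) = f"
proof (rule poly_mapping_eqI)
  fix g
  show "Poly_Mapping.lookup (\<Sum>v\<in>\<phi> ` Poly_Mapping.keys f. part {g. \<phi> g = v} f) g
      = Poly_Mapping.lookup f g"
    by (cases "g \<in> Poly_Mapping.keys f") (auto simp: lookup_sum lookup_part in_keys_iff)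
qed

text \<open>The combinatorial core of coprimality. Modulo \<open>a\<close>, the hypothesis \<open>a dvd (1 + X^t) * c\<close> says that
  multiplication by \<open>X^t\<close> changes only the sign of \<open>c\<close>, so the same holds up to sign for each power
  \<open>X^(n t)\<close>. As no nonzero multiple of \<open>t\<close> lies in \<open>H\<close>, some such power moves the support of \<open>c\<close> to
  \<open>H\<close>-cosets that \<open>c\<close> does not meet. Restriction to the cosets that \<open>c\<close> does meet preserves
  multiples of \<open>a\<close>, kills \<open>X^(n t) * c\<close> and leaves \<open>c\<close>. The argument covers \<open>a = 0\<close>, where it shows
  that the binomial is not a zero divisor, and \<open>a = 2\<close>.\<close>

lemma nonzerodiv_mod_transversal_binomial:
  assumes H: "Poly_Mapping.keys a \<subseteq> H"
    and H_add: "\<And>g h. g \<in> H \<Longrightarrow> h \<in> H \<Longrightarrow> g + h \<in> H"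
    and H_minus: "\<And>g. g \<in> H \<Longrightarrow> - g \<in> H"
    and H_zero: "0 \<in> H"
    and trans: "\<And>n. n \<noteq> 0 \<Longrightarrow> zmul n t \<notin> H"
  shows "nonzerodiv_mod a (1 + monom_of t)"
  unfolding nonzerodiv_mod_def
proof (intro allI impI)
  fix c assume ac: "a dvd (1 + monom_of t) * c"
  have shift: "a dvd monom_of (zmul (int n) t) * c - (- 1) ^ n * c" for n
  proof (induction n)
    case (Suc n)
    have "monom_of (zmul (int (Suc n)) t) = monom_of t * monom_of (zmul (int n) t)"
      by (simp add: mult_single zmul_add)
    then have "monom_of (zmul (int (Suc n)) t) * c - (- 1) ^ Suc n * c
        = monom_of t * (monom_of (zmul (int n) t) * c - (- 1) ^ n * c)
          + (- 1) ^ n * ((1 + monom_of t) * c)"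
      by (simp add: algebra_simps)
    then show ?case using Suc ac by (metis dvd_add dvd_mult)
  qed simp
  let ?K = "Poly_Mapping.keys c"
  define bad where "bad g h = {n :: nat. g + zmul (int n) t - h \<in> H}" for g h
  have "finite (bad g h)" for g h
  proof (cases "bad g h = {}")
    case False
    then obtain m where m: "g + zmul (int m) t - h \<in> H" by (auto simp: bad_def)
    have "n = m" if "n \<in> bad g h" for n
    proof (rule ccontr)
      assume "n \<noteq> m"
      have "(g + zmul (int n) t - h) + - (g + zmul (int m) t - h) \<in> H"
        using that m by (intro H_add H_minus) (auto simp: bad_def)
      then have "zmul (int n - int m) t \<in> H" by (simp add: zmul_diff)
      with \<open>n \<noteq> m\<close> trans[of "int n - int m"] show False by simp
    qed
    then have "bad g h \<subseteq> {m}" by blast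
    then show ?thesis by (rule finite_subset) simp
  qed simp
  then have "finite (\<Union>g\<in>?K. \<Union>h\<in>?K. bad g h)" by simp
  then obtain n where n: "n \<notin> (\<Union>g\<in>?K. \<Union>h\<in>?K. bad g h)"
    using ex_new_if_finite[OF infinite_UNIV_nat] by blast
  define C where "C = {k. \<exists>h\<in>?K. k - h \<in> H}"
  have stable: "g + k \<in> C \<longleftrightarrow> k \<in> C" if "g \<in> Poly_Mapping.keys a" for g k
  proof -
    have "g \<in> H" using that H by blast
    have "g + k - h \<in> H \<longleftrightarrow> k - h \<in> H" for h
    proof
      assume "g + k - h \<in> H"
      then have "- g + (g + k - h) \<in> H" using H_add H_minus \<open>g \<in> H\<close> by blast
      then show "k - h \<in> H" by simp
    next
      assume "k - h \<in> H"
      then have "g + (k - h) \<in> H" using H_add \<open>g \<in> H\<close> by blast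
      then show "g + k - h \<in> H" by (simp add: algebra_simps)
    qed
    then show ?thesis by (simp add: C_def)
  qed
  have "?K \<subseteq> C" using H_zero by (force simp: C_def)
  moreover have "Poly_Mapping.keys (monom_of (zmul (int n) t) * c) \<inter> C = {}"
  proof -
    have "Poly_Mapping.keys (monom_of (zmul (int n) t) * c) \<subseteq> (\<lambda>g. g + zmul (int n) t) ` ?K"
      using keys_mult[of "monom_of (zmul (int n) t)" c] by (force simp: add.commute)
    then show ?thesis using n by (fastforce simp: C_def bad_def)
  qed
  moreover have "part C ((- 1) ^ n * c) = (- 1) ^ n * c"
    using \<open>?K \<subseteq> C\<close> by (cases "even n") (simp_all add: part_idem)
  ultimately have "part C (monom_of (zmul (int n) t) * c - (- 1) ^ n * c) = - ((- 1) ^ n * c)"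
    by (simp add: part_diff part_eq_0)
  moreover obtain q where "monom_of (zmul (int n) t) * c - (- 1) ^ n * c = a * q"
    using shift[of n] ..
  ultimately have "- ((- 1) ^ n * c) = a * part C q"
    using part_mult[of a C, OF stable] by metis
  then have "a dvd - ((- 1) ^ n * c)" by simp
  then show "a dvd c" by (cases "even n") simp_all
qed

section \<open>Binomials in the group ring of a torsion-free group\<close>

lemma nonzerodiv_mod_two:
  assumes tf: "torsion_free TYPE('g)" and "t \<noteq> 0"
  shows "nonzerodiv_mod 2 (1 + monom_of (t :: 'g::ab_group_add))"
  by (rule nonzerodiv_mod_transversal_binomial[where H = "{0}"])
    (use assms in \<open>auto simp: zmul_eq_0_iff[OF tf] in_keys_iff lookup_numeral when_def split: if_splits\<close>)

lemma nonzerodiv_two: "nonzerodiv_mod 0 (2 :: 'g::ab_group_add \<Rightarrow>\<^sub>0 int)"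
  unfolding nonzerodiv_mod_def
proof (intro allI impI)
  fix c :: "'g \<Rightarrow>\<^sub>0 int" assume "0 dvd 2 * c"
  then have "c + c = 0" by simp
  then have "Poly_Mapping.lookup c g + Poly_Mapping.lookup c g = 0" for g
    by (metis lookup_add lookup_zero)
  then have "c = 0" by (intro poly_mapping_eqI) simp
  then show "0 dvd c" by simp
qed

lemma nonzerodiv_binomial:
  assumes tf: "torsion_free TYPE('g)"
  shows "nonzerodiv_mod 0 (1 + monom_of (t :: 'g::ab_group_add))"
proof (cases "t = 0")
  case True
  then show ?thesis using nonzerodiv_two by simp
next
  case False
  then show ?thesis
    by (intro nonzerodiv_mod_transversal_binomial[where H = "{0}"])
      (use assms in \<open>auto simp: zmul_eq_0_iff[OF tf]\<close>)
qed

lemma monom_of_zmul_cong_sign: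
  "1 + monom_of t dvd monom_of (zmul k t) - (if even k then 1 else - 1)"
proof (induction k rule: int_induct[of _ 0])
  case (step1 k)
  have "monom_of (zmul (k + 1) t) - (if even (k + 1) then 1 else - 1)
      = monom_of t * (monom_of (zmul k t) - (if even k then 1 else - 1))
        + (if even k then 1 else - 1) * (1 + monom_of t)"
    by (simp add: zmul_add mult_single add.commute algebra_simps)
  then show ?case using step1 by (metis dvd_add dvd_mult dvd_triv_right)
next
  case (step2 k)
  have "monom_of (- t) * monom_of (zmul k t) = monom_of (zmul (k - 1) t)"
    "monom_of (- t) * monom_of t = 1"
    by (simp_all add: zmul_diff mult_single)
  then have "monom_of (zmul (k - 1) t) - (if even (k - 1) then 1 else - 1)
      = monom_of (- t) * (monom_of (zmul k t) - (if even k then 1 else - 1))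
        + (if even k then 1 else - 1) * monom_of (- t) * (1 + monom_of t)"
    by (simp add: algebra_simps)
  then show ?case using step2 by (metis dvd_add dvd_mult dvd_triv_right)
qed simp

text \<open>Independent \<open>t\<close> and \<open>t'\<close> are transversal, so the second binomial cancels modulo the first.
  Otherwise both are multiples of some \<open>s\<close> with coprime coefficients \<open>k\<close> and \<open>l\<close>. When these have
  opposite parity, the monomial \<open>X^(k l s)\<close> is congruent to \<open>1\<close> modulo one binomial and to \<open>-1\<close> modulo
  the other, so that the two generate an ideal containing \<open>2\<close>; and \<open>2\<close> cancels modulo \<open>1 + X^t\<close>
  when \<open>t\<close> is not zero. What remains are odd coefficients, for which \<open>1 + X^s\<close> divides both
  binomials; the case \<open>t = t' = 0\<close>, where both binomials are \<open>2\<close>, is of this kind with \<open>s = 0\<close>.\<close>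

lemma binomials_coprime_or_odd_multiples:
  fixes t t' :: "'g::ab_group_add"
  assumes tf: "torsion_free TYPE('g)"
  obtains (coprime) "nonzerodiv_mod (1 + monom_of t) (1 + monom_of t')"
    | (odd) s k l where "odd k" "odd l" "t = zmul k s" "t' = zmul l s"
proof (cases "\<exists>n m. n \<noteq> 0 \<and> zmul n t' = zmul m t")
  case False
  have "nonzerodiv_mod (1 + monom_of t) (1 + monom_of t')"
  proof (rule nonzerodiv_mod_transversal_binomial[where H = "range (\<lambda>m. zmul m t)"])
    show zero: "0 \<in> range (\<lambda>m. zmul m t)" using zmul_0[of t, symmetric] by blast
    have "t \<in> range (\<lambda>m. zmul m t)" using zmul_1[of t, symmetric] by blast
    then show "Poly_Mapping.keys (1 + monom_of t) \<subseteq> range (\<lambda>m. zmul m t)"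
      using keys_add[of 1 "monom_of t"] zero by auto
    show "zmul n t' \<notin> range (\<lambda>m. zmul m t)" if "n \<noteq> 0" for n using False that by blast
  qed (auto simp flip: zmul_add zmul_minus)
  then show ?thesis by (rule coprime)
next
  case True
  then obtain n m where "n \<noteq> 0" "zmul n t' = zmul m t" by blast
  then obtain k l s where kls: "coprime k l" "t' = zmul l s" "t = zmul k s"
    by (rule commensurable_imp_common_generator[OF tf])
  consider "t = 0" "t' = 0" | "odd k" "odd l" | "t = 0" "t' \<noteq> 0" | "t \<noteq> 0" "even k \<noteq> even l"
    using kls(1) by (metis coprime_common_divisor even_Suc odd_one)
  then show ?thesis
  proof cases
    case 1
    then show ?thesis using odd[of 1 1 0] by simp
  next
    case 2
    then show ?thesis using odd kls by blast
  next
    case 3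
    then show ?thesis using nonzerodiv_mod_two[OF tf, of t'] coprime by simp
  next
    case 4
    have two: "nonzerodiv_mod (1 + monom_of t) 2"
      by (rule nonzerodiv_mod_sym[OF nonzerodiv_two nonzerodiv_mod_two[OF tf 4(1)]])
    have eq: "zmul l t = zmul k t'" by (simp add: kls(2,3) mult.commute flip: zmul_mult)
    define e :: "int \<Rightarrow> ('g \<Rightarrow>\<^sub>0 int)" where "e n = (if even n then 1 else - 1)" for n
    obtain y where y: "monom_of (zmul l t) - e l = (1 + monom_of t) * y"
      using monom_of_zmul_cong_sign[of t l] unfolding e_def by (auto elim: dvdE)
    obtain z where z: "monom_of (zmul l t) - e k = (1 + monom_of t') * z"
      using monom_of_zmul_cong_sign[of t' k] unfolding e_def eq by (auto elim: dvdE)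
    have "nonzerodiv_mod (1 + monom_of t) (1 + monom_of t')"
      unfolding nonzerodiv_mod_def
    proof (intro allI impI)
      fix c assume "1 + monom_of t dvd (1 + monom_of t') * c"
      then have "1 + monom_of t dvd (1 + monom_of t') * c * z - (1 + monom_of t) * y * c" by simp
      moreover have "(1 + monom_of t') * c * z - (1 + monom_of t) * y * c = (e l - e k) * c"
      proof -
        have "(1 + monom_of t') * c * z - (1 + monom_of t) * y * c
            = ((1 + monom_of t') * z - (1 + monom_of t) * y) * c" by (simp add: algebra_simps)
        then show ?thesis unfolding y[symmetric] z[symmetric] by simp
      qed
      moreover have "e l - e k = 2 \<or> e l - e k = - 2" using 4(2) by (auto simp: e_def)
      ultimately have "1 + monom_of t dvd 2 * c" by (metis dvd_minus_iff minus_mult_left)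
      then show "1 + monom_of t dvd c" by (rule nonzerodiv_modD[OF two])
    qed
    then show ?thesis by (rule coprime)
  qed
qed

section \<open>Evaluation of group ring elements\<close>

definition eval_at :: "('g::ab_group_add \<Rightarrow> 'f::field) \<Rightarrow> ('g \<Rightarrow>\<^sub>0 int) \<Rightarrow> 'f" where
  "eval_at e c = (\<Sum>g\<in>Poly_Mapping.keys c. of_int (Poly_Mapping.lookup c g) * e g)"

lemma eval_at_superset:
  assumes "finite A" "Poly_Mapping.keys c \<subseteq> A"
  shows "eval_at e c = (\<Sum>g\<in>A. of_int (Poly_Mapping.lookup c g) * e g)"
  unfolding eval_at_def using assms by (intro sum.mono_neutral_left) (auto simp: in_keys_iff)

lemma eval_at_0 [simp]: "eval_at e 0 = 0"
  by (simp add: eval_at_def)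

lemma eval_at_add: "eval_at e (c + d) = eval_at e c + eval_at e d"
proof -
  let ?A = "Poly_Mapping.keys c \<union> Poly_Mapping.keys d"
  have "eval_at e (c + d) = (\<Sum>g\<in>?A. of_int (Poly_Mapping.lookup (c + d) g) * e g)"
    using keys_add[of c d] by (intro eval_at_superset) auto
  then show ?thesis
    by (simp add: eval_at_superset[of ?A c] eval_at_superset[of ?A d] lookup_add distrib_right
        sum.distrib)
qed

lemma eval_at_minus: "eval_at e (- c) = - eval_at e c"
  by (simp add: eval_at_def sum_negf)

lemma eval_at_diff: "eval_at e (c - d) = eval_at e c - eval_at e d"
  using eval_at_add[of e c "- d"] by (simp add: eval_at_minus)

lemma eval_at_sum: "eval_at e (\<Sum>i\<in>I. f i) = (\<Sum>i\<in>I. eval_at e (f i))"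
  by (induction I rule: infinite_finite_induct) (simp_all add: eval_at_add)

lemma eval_at_single: "eval_at e (Poly_Mapping.single g n) = of_int n * e g"
  by (cases "n = 0") (simp_all add: eval_at_def)

lemma sum_monomials: "(\<Sum>g\<in>Poly_Mapping.keys c. Poly_Mapping.single g (Poly_Mapping.lookup c g)) = c"
  by (rule poly_mapping_eqI) (simp add: lookup_sum lookup_single when_def in_keys_iff)

lemma eval_at_mult:
  assumes "\<And>g h. e (g + h) = e g * e h"
  shows "eval_at e (c * d) = eval_at e c * eval_at e d"
proof -
  let ?s = "\<lambda>c g. Poly_Mapping.single g (Poly_Mapping.lookup c g)"
  have "eval_at e (c * d) = eval_at e ((\<Sum>g\<in>Poly_Mapping.keys c. ?s c g) * (\<Sum>h\<in>Poly_Mapping.keys d. ?s d h))"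
    by (simp only: sum_monomials)
  also have "\<dots> = (\<Sum>g\<in>Poly_Mapping.keys c. \<Sum>h\<in>Poly_Mapping.keys d. eval_at e (?s c g) * eval_at e (?s d h))"
    by (simp add: sum_product eval_at_sum mult_single eval_at_single assms algebra_simps)
  also have "\<dots> = eval_at e c * eval_at e d"
    by (simp add: eval_at_single flip: sum_product) (simp add: eval_at_def)
  finally show ?thesis .
qed

text \<open>The augmentation is \<open>2\<close> on the left and \<open>1\<close> or \<open>-1\<close> on the right.\<close>

lemma sum_of_monomials_not_unit: "monom_of g + monom_of h \<noteq> monom_of k" "monom_of g + monom_of h \<noteq> - monom_of k"
proof -
  let ?aug = "eval_at (\<lambda>_. 1 :: rat)"
  have "?aug (monom_of g + monom_of h) = 2" "?aug (monom_of k) = 1" "?aug (- monom_of k) = -1"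
    by (simp_all add: eval_at_add eval_at_single eval_at_minus)
  then show "monom_of g + monom_of h \<noteq> monom_of k" "monom_of g + monom_of h \<noteq> - monom_of k"
    by fastforce+
qed

section \<open>Subrings generated inside a field\<close>

lemma is_subringD:
  assumes "is_subring R"
  shows "0 \<in> R" "1 \<in> R" "a \<in> R \<Longrightarrow> - a \<in> R" "a \<in> R \<Longrightarrow> b \<in> R \<Longrightarrow> a + b \<in> R"
    "a \<in> R \<Longrightarrow> b \<in> R \<Longrightarrow> a * b \<in> R" "a \<in> R \<Longrightarrow> b \<in> R \<Longrightarrow> a - b \<in> R"
  using assms unfolding is_subring_def diff_conv_add_uminus by blast+

lemma subring_power: "is_subring R \<Longrightarrow> a \<in> R \<Longrightarrow> a ^ n \<in> R"
  by (induction n) (simp_all add: is_subringD)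

lemma subring_sum: "is_subring R \<Longrightarrow> (\<And>i. i \<in> I \<Longrightarrow> f i \<in> R) \<Longrightarrow> sum f I \<in> R"
  by (induction I rule: infinite_finite_induct) (simp_all add: is_subringD)

lemma subring_prod: "is_subring R \<Longrightarrow> (\<And>i. i \<in> I \<Longrightarrow> f i \<in> R) \<Longrightarrow> prod f I \<in> R"
  by (induction I rule: infinite_finite_induct) (simp_all add: is_subringD)

lemma subring_of_int: "is_subring R \<Longrightarrow> of_int n \<in> R"
  by (induction n rule: int_induct[of _ 0]) (simp_all add: is_subringD)

lemma subring_powi:
  "is_subring R \<Longrightarrow> a \<in> R \<Longrightarrow> 0 \<le> n \<or> inverse a \<in> R \<Longrightarrow> a powi n \<in> R"
  by (auto simp: power_int_def subring_power)

lemma is_subring_ring_adjoin: "is_subring (ring_adjoin R S)"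
  unfolding ring_adjoin_def
proof (rule hull_in)
  show "is_subring (\<Inter>T)" if "\<forall>A\<in>T. is_subring A" for T :: "'a set set"
    using that unfolding is_subring_def by auto
qed

lemma ring_adjoin_base: "a \<in> R \<Longrightarrow> a \<in> ring_adjoin R S"
  unfolding ring_adjoin_def using hull_subset[of "R \<union> S"] by blast

lemma ring_adjoin_gen: "a \<in> S \<Longrightarrow> a \<in> ring_adjoin R S"
  unfolding ring_adjoin_def using hull_subset[of "R \<union> S"] by blast

lemma ring_adjoin_least: "R \<subseteq> T \<Longrightarrow> S \<subseteq> T \<Longrightarrow> is_subring T \<Longrightarrow> ring_adjoin R S \<subseteq> T"
  unfolding ring_adjoin_def by (intro hull_minimal) auto

lemma odd_sum_powers_factor:
  fixes v w :: "'f::field"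
  assumes R: "is_subring R" and "v \<in> R" "w \<in> R" "odd n"
  shows "\<exists>q\<in>R. v ^ n + w ^ n = (v + w) * q"
proof -
  obtain m where n: "n = Suc m" using \<open>odd n\<close> by (cases n) auto
  have "v ^ n - (- w) ^ n = (v - (- w)) * (\<Sum>i<Suc m. v ^ i * (- w) ^ (m - i))"
    unfolding n by (rule diff_power_eq_sum)
  then have "v ^ n + w ^ n = (v + w) * (\<Sum>i<Suc m. v ^ i * (- w) ^ (m - i))"
    using \<open>odd n\<close> by simp
  moreover have "(\<Sum>i<Suc m. v ^ i * (- w) ^ (m - i)) \<in> R"
    using assms(2,3) by (intro subring_sum[OF R] is_subringD(5)[OF R] subring_power[OF R] is_subringD(3)[OF R])
  ultimately show ?thesis by blast
qed

text \<open>The basic open sets where \<open>a\<close>, respectively \<open>b\<close>, is invertible cover the spectrum of \<open>R\<close>, since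
  \<open>a\<close> and \<open>b\<close> generate the unit ideal. The element \<open>u\<close> is a regular function on both.\<close>

lemma mem_subring_if_comaximal_multiples:
  assumes R: "is_subring R" and ab: "a \<in> R" "b \<in> R"
    and unit: "c \<in> R" "d \<in> R" "c * a + d * b = 1"
    and "a ^ m * u \<in> R" "b ^ n * u \<in> R"
  shows "u \<in> R"
  using assms(7,8)
proof (induction "m + n" arbitrary: m n u)
  case 0
  then show ?case by simp
next
  case (Suc l)
  show ?case
  proof (cases "m = 0 \<or> n = 0")
    case True
    then show ?thesis using Suc.prems by auto
  next
    case False
    then obtain m' n' where mn: "m = Suc m'" "n = Suc n'" by (metis not0_implies_Suc)
    have "b ^ n * (a * u) \<in> R" "a ^ m * (b * u) \<in> R"
      using Suc.prems ab R by (metis is_subringD(5) mult.left_commute)+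
    moreover have "a ^ m' * (a * u) \<in> R" "b ^ n' * (b * u) \<in> R"
      using Suc.prems by (simp_all add: mn ac_simps)
    ultimately have "a * u \<in> R" "b * u \<in> R"
      using Suc.hyps(1)[of m' n "a * u"] Suc.hyps(1)[of m n' "b * u"] Suc.hyps(2) mn by auto
    then have "c * (a * u) + d * (b * u) \<in> R"
      using unit(1,2) by (simp add: is_subringD[OF R])
    moreover have "c * (a * u) + d * (b * u) = (c * a + d * b) * u" by (simp add: algebra_simps)
    ultimately show ?thesis by (simp add: unit)
  qed
qed

section \<open>Laurent polynomials over a group ring\<close>

lemma inj_ring_hom_simps:
  fixes h :: "'r::ring_1 \<Rightarrow> 'f::ring_1"
  assumes "inj_ring_hom h"
  shows "h (a + b) = h a + h b" "h (a * b) = h a * h b" "h 1 = 1" "h 0 = 0" "h (- a) = - h a"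
    "h a = 0 \<longleftrightarrow> a = 0"
proof -
  show add: "h (a + b) = h a + h b" for a b using assms unfolding inj_ring_hom_def by blast
  show "h (a * b) = h a * h b" "h 1 = 1" using assms unfolding inj_ring_hom_def by blast+
  show zero: "h 0 = 0" using add[of 0 0] by simp
  show "h (- a) = - h a" using add[of a "- a"] zero by (simp add: minus_unique)
  show "h a = 0 \<longleftrightarrow> a = 0" using assms zero unfolding inj_ring_hom_def inj_def by metis
qed

lemma inj_ring_hom_sum: "inj_ring_hom h \<Longrightarrow> h (sum f I) = (\<Sum>i\<in>I. h (f i))"
  by (induction I rule: infinite_finite_induct) (simp_all add: inj_ring_hom_simps)

lemma inj_ring_hom_single:
  fixes \<iota> :: "('p::ab_group_add \<Rightarrow>\<^sub>0 int) \<Rightarrow> 'f::field"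
  assumes "inj_ring_hom \<iota>"
  shows "\<iota> (Poly_Mapping.single p n) = of_int n * \<iota> (monom_of p)"
proof (induction n rule: int_induct[of _ 0])
  case (step1 n)
  then show ?case by (simp add: single_add inj_ring_hom_simps[OF assms] algebra_simps)
next
  case (step2 n)
  have "Poly_Mapping.single p n = Poly_Mapping.single p (n - 1) + monom_of p"
    by (simp flip: single_add)
  with step2 show ?case by (simp add: inj_ring_hom_simps[OF assms] algebra_simps)
qed (simp add: inj_ring_hom_simps[OF assms])

text \<open>Laurent polynomials with coefficients in the group ring of \<open>'p\<close> are themselves a group ring,
  of the group \<open>'p \<times> ('n \<Rightarrow> int)\<close> that has the exponent vectors as second components.\<close>

definition laurent_monom ::
  "(('p::ab_group_add \<Rightarrow>\<^sub>0 int) \<Rightarrow> 'f::field) \<Rightarrow> ('n::finite \<Rightarrow> 'f) \<Rightarrow> 'p \<times> ('n \<Rightarrow> int) \<Rightarrow> 'f"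
  where "laurent_monom \<iota> y g = \<iota> (monom_of (fst g)) * (\<Prod>i\<in>UNIV. y i powi snd g i)"

abbreviation unit_vec :: "'n \<Rightarrow> int \<Rightarrow> 'n \<Rightarrow> int" where
  "unit_vec i n \<equiv> (\<lambda>k. if k = i then n else 0)"

lemma laurent_monom_unit_vec:
  assumes "inj_ring_hom \<iota>"
  shows "laurent_monom \<iota> y (0, unit_vec i n) = y i powi n"
proof -
  have "(\<Prod>k\<in>UNIV. y k powi unit_vec i n k) = (\<Prod>k\<in>UNIV. if k = i then y i powi n else 1)"
    by (intro prod.cong) auto
  then show ?thesis by (simp add: laurent_monom_def inj_ring_hom_simps[OF assms])
qed

lemma laurent_monom_add:
  assumes "inj_ring_hom \<iota>" "\<And>i. y i \<noteq> 0"
  shows "laurent_monom \<iota> y (g + h) = laurent_monom \<iota> y g * laurent_monom \<iota> y h"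
proof -
  have "monom_of (fst (g + h)) = monom_of (fst g) * monom_of (fst h)" by (simp add: mult_single)
  then show ?thesis
    using assms(2) by (simp add: laurent_monom_def inj_ring_hom_simps[OF assms(1)] power_int_add
        prod.distrib algebra_simps)
qed

lemma laurent_monom_zero: "inj_ring_hom \<iota> \<Longrightarrow> laurent_monom \<iota> y 0 = 1"
  by (simp add: laurent_monom_def inj_ring_hom_simps)

lemma laurent_ring_subset_eval:
  fixes y :: "'n::finite \<Rightarrow> 'f::field"
  assumes h: "inj_ring_hom \<iota>" and y: "\<And>i. y i \<noteq> 0"
  shows "laurent_ring \<iota> y \<subseteq> range (eval_at (laurent_monom \<iota> y))"
  unfolding laurent_ring_def
proof (rule ring_adjoin_least)
  let ?E = "eval_at (laurent_monom \<iota> y)"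
  have mult: "?E (c * d) = ?E c * ?E d" for c d
    by (rule eval_at_mult) (rule laurent_monom_add[OF h y])
  have one: "?E 1 = 1"
    using eval_at_single[of "laurent_monom \<iota> y" 0 1] laurent_monom_zero[OF h, of y] by simp
  show "is_subring (range ?E)"
    unfolding is_subring_def
  proof (intro conjI ballI)
    show "0 \<in> range ?E" "1 \<in> range ?E" using eval_at_0 one by (metis rangeI)+
    fix a b assume "a \<in> range ?E" "b \<in> range ?E"
    then obtain c d where "a = ?E c" "b = ?E d" by blast
    then have "- a = ?E (- c)" "a + b = ?E (c + d)" "a * b = ?E (c * d)"
      by (simp_all add: eval_at_minus eval_at_add mult)
    then show "- a \<in> range ?E" "a + b \<in> range ?E" "a * b \<in> range ?E" by blast+
  qed
  show "range \<iota> \<subseteq> range ?E"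
  proof (rule image_subsetI)
    fix r
    have single: "\<iota> (Poly_Mapping.single p (Poly_Mapping.lookup r p))
        = of_int (Poly_Mapping.lookup r p) * \<iota> (monom_of p)" for p
      by (rule inj_ring_hom_single[OF h])
    have "\<iota> r = \<iota> (\<Sum>p\<in>Poly_Mapping.keys r. Poly_Mapping.single p (Poly_Mapping.lookup r p))"
      by (simp only: sum_monomials)
    also have "\<dots> = ?E (\<Sum>p\<in>Poly_Mapping.keys r. Poly_Mapping.single (p, 0) (Poly_Mapping.lookup r p))"
      by (simp add: inj_ring_hom_sum[OF h] eval_at_sum eval_at_single single laurent_monom_def)
    finally show "\<iota> r \<in> range ?E" by blast
  qed
  have gen: "y i powi n \<in> range ?E" for i n
  proof -
    have "y i powi n = ?E (monom_of (0, unit_vec i n))"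
      by (simp add: eval_at_single laurent_monom_unit_vec[OF h])
    then show ?thesis by blast
  qed
  show "range y \<union> range (\<lambda>i. inverse (y i)) \<subseteq> range ?E"
    using gen[of _ 1] gen[of _ "- 1"] by (auto simp: power_int_minus)
qed

lemma eval_mpoly_superset:
  assumes "finite A" "Poly_Mapping.keys q \<subseteq> A"
  shows "eval_mpoly q x
    = (\<Sum>m\<in>A. Poly_Mapping.lookup q m * (\<Prod>i\<in>UNIV. x i ^ Poly_Mapping.lookup m i))"
  unfolding eval_mpoly_def using assms by (intro sum.mono_neutral_left) (auto simp: in_keys_iff)

lemma eval_mpoly_add: "eval_mpoly (p + q) x = eval_mpoly p x + eval_mpoly q x"
proof -
  let ?A = "Poly_Mapping.keys p \<union> Poly_Mapping.keys q"
  have "eval_mpoly (p + q) x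
      = (\<Sum>m\<in>?A. Poly_Mapping.lookup (p + q) m * (\<Prod>i\<in>UNIV. x i ^ Poly_Mapping.lookup m i))"
    using keys_add[of p q] by (intro eval_mpoly_superset) auto
  then show ?thesis
    by (simp add: eval_mpoly_superset[of ?A p] eval_mpoly_superset[of ?A q] lookup_add
        distrib_right sum.distrib)
qed

lemma eval_mpoly_sum: "eval_mpoly (\<Sum>i\<in>I. q i) x = (\<Sum>i\<in>I. eval_mpoly (q i) x)"
proof (induction I rule: infinite_finite_induct)
  case (insert i I)
  then show ?case by (simp add: eval_mpoly_add)
qed (simp_all add: eval_mpoly_def)

lemma eval_mpoly_single:
  "eval_mpoly (Poly_Mapping.single m a) x = a * (\<Prod>i\<in>UNIV. x i ^ Poly_Mapping.lookup m i)"
  by (cases "a = 0") (simp_all add: eval_mpoly_def)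

text \<open>Algebraic independence speaks of polynomials, so the Laurent polynomial is first multiplied by
  a monomial with a large exponent \<open>N\<close> in every variable.\<close>

lemma laurent_eval_eq_0_imp:
  fixes x :: "'n::finite \<Rightarrow> 'f::field"
  assumes h: "inj_ring_hom \<iota>" and indep: "alg_independent (fraction_field \<iota>) x"
    and x: "\<And>i. x i \<noteq> 0" and zero: "eval_at (laurent_monom \<iota> x) c = 0"
  shows "c = 0"
proof (rule ccontr)
  assume "c \<noteq> 0"
  let ?K = "Poly_Mapping.keys c" and ?c = "Poly_Mapping.lookup c"
  from \<open>c \<noteq> 0\<close> obtain k0 where k0: "k0 \<in> ?K" by (metis ex_in_conv keys_eq_empty)
  define N where "N = (\<Sum>k\<in>?K. \<Sum>i\<in>UNIV. \<bar>snd k i\<bar>)"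
  have N: "0 \<le> snd k i + N" if "k \<in> ?K" for k i
  proof -
    have "\<bar>snd k i\<bar> \<le> (\<Sum>i\<in>UNIV. \<bar>snd k i\<bar>)" by (rule member_le_sum) auto
    also have "\<dots> \<le> N" unfolding N_def using that by (intro member_le_sum) (auto intro: sum_nonneg)
    finally show ?thesis by linarith
  qed
  define sh where "sh k = Abs_poly_mapping (\<lambda>i. nat (snd k i + N))" for k :: "'a \<times> ('n \<Rightarrow> int)"
  have sh: "Poly_Mapping.lookup (sh k) i = nat (snd k i + N)" for k i
    by (simp add: sh_def)
  define q where "q = (\<Sum>k\<in>?K. Poly_Mapping.single (sh k) (\<iota> (Poly_Mapping.single (fst k) (?c k))))"
  have "eval_mpoly q x = (\<Sum>k\<in>?K. of_int (?c k) * laurent_monom \<iota> x k * (\<Prod>i\<in>UNIV. x i powi N))"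
    unfolding q_def eval_mpoly_sum
  proof (rule sum.cong)
    fix k assume "k \<in> ?K"
    have "x i ^ nat (snd k i + N) = x i powi (snd k i + N)" for i
      using N[OF \<open>k \<in> ?K\<close>, of i] by (simp add: power_int_def)
    then have "(\<Prod>i\<in>UNIV. x i ^ Poly_Mapping.lookup (sh k) i)
        = (\<Prod>i\<in>UNIV. x i powi snd k i * x i powi N)"
      using x by (simp add: sh power_int_add)
    then show "eval_mpoly (Poly_Mapping.single (sh k) (\<iota> (Poly_Mapping.single (fst k) (?c k)))) x
        = of_int (?c k) * laurent_monom \<iota> x k * (\<Prod>i\<in>UNIV. x i powi N)"
      using inj_ring_hom_single[OF h, of "fst k" "?c k"]
      by (simp add: eval_mpoly_single laurent_monom_def prod.distrib)
  qed simp
  also have "\<dots> = 0" using zero by (simp add: eval_at_def flip: sum_distrib_right)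
  finally have q0: "eval_mpoly q x = 0" .
  define r where "r m = (\<Sum>k\<in>?K. if sh k = m then Poly_Mapping.single (fst k) (?c k) else 0)" for m
  have lookup_q: "Poly_Mapping.lookup q m = \<iota> (r m)" for m
    by (auto simp: q_def r_def lookup_sum inj_ring_hom_sum[OF h] lookup_single when_def
        inj_ring_hom_simps[OF h] intro!: sum.cong)
  have "Poly_Mapping.lookup q m \<in> fraction_field \<iota>" for m
  proof -
    have "\<iota> (r m) = \<iota> (r m) / \<iota> 1" by (simp add: inj_ring_hom_simps[OF h])
    then show ?thesis unfolding lookup_q fraction_field_def by (metis (mono_tags, lifting) mem_Collect_eq one_neq_zero)
  qed
  with indep q0 have "q = 0" unfolding alg_independent_def by blast
  then have "r (sh k0) = 0" using lookup_q[of "sh k0"] by (simp add: inj_ring_hom_simps[OF h])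
  moreover have "Poly_Mapping.lookup (r (sh k0)) (fst k0) = (\<Sum>k\<in>?K. if k = k0 then ?c k else 0)"
    unfolding r_def lookup_sum
  proof (rule sum.cong)
    fix k assume k: "k \<in> ?K"
    have "snd k = snd k0" if "sh k = sh k0"
    proof
      fix i
      have "nat (snd k i + N) = nat (snd k0 i + N)" using that by (metis sh)
      then show "snd k i = snd k0 i" using N[OF k, of i] N[OF k0, of i] by simp
    qed
    then have "k = k0 \<longleftrightarrow> sh k = sh k0 \<and> fst k = fst k0" by (auto intro: prod_eqI)
    then show "Poly_Mapping.lookup (if sh k = sh k0 then Poly_Mapping.single (fst k) (?c k) else 0) (fst k0)
        = (if k = k0 then ?c k else 0)"
      by (simp add: lookup_single when_def)
  qed simp
  ultimately have "?c k0 = 0" using k0 by simp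
  then show False using k0 by (simp add: in_keys_iff)
qed

section \<open>Exchange polynomials as binomials\<close>

lemma sum_fun_apply: "(\<Sum>i\<in>I. f i) a = (\<Sum>i\<in>I. f i a)"
  by (induction I rule: infinite_finite_induct) simp_all

lemma torsion_free_exponents:
  assumes "torsion_free TYPE('p::ab_group_add)"
  shows "torsion_free TYPE('p \<times> ('n \<Rightarrow> int))"
  unfolding torsion_free_def
proof (intro allI impI)
  fix g :: "'p \<times> ('n \<Rightarrow> int)" and k :: nat
  assume k: "0 < k" and sum: "(\<Sum>i<k. g) = 0"
  have "(\<Sum>i<k. fst g) = 0" using arg_cong[OF sum, of fst] by (simp add: fst_sum)
  then have "fst g = 0" using assms k unfolding torsion_free_def by blast
  moreover have "snd g = 0"
  proof
    fix i
    have "(\<Sum>j<k. snd g) i = 0" using arg_cong[OF sum, of snd] by (simp add: snd_sum)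
    then show "snd g i = 0 i" using k by (simp add: sum_fun_apply)
  qed
  ultimately show "g = 0" by (simp add: prod_eq_iff)
qed

lemma fst_zmul: "fst (zmul k g) = zmul k (fst g)"
  by (simp add: zmul_def fst_sum)

lemma snd_zmul_apply:
  fixes g :: "'p::ab_group_add \<times> ('n \<Rightarrow> int)"
  shows "snd (zmul k g) i = k * snd g i"
  by (simp add: zmul_def snd_sum sum_fun_apply del: sum_constant) simp

lemma monom_of_power: "monom_of g ^ n = monom_of (zmul (int n) g)"
  by (induction n) (simp_all add: mult_single zmul_add add.commute)

lemma nonzerodiv_mod_unit_multiples:
  assumes ab: "nonzerodiv_mod a b" and u: "u * u' = 1" and v: "v * v' = 1"
  shows "nonzerodiv_mod (u * a) (v * b)"
  unfolding nonzerodiv_mod_def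
proof (intro allI impI)
  fix c assume "u * a dvd v * b * c"
  then have "a dvd b * (v * c)" by (metis dvd_mult_right mult.assoc mult.left_commute)
  then have "a dvd v * c" by (rule nonzerodiv_modD[OF ab])
  then have "a dvd v' * (v * c)" by simp
  then have "a dvd c" using v by (metis mult.assoc mult.commute mult_1)
  then obtain d where "c = a * d" ..
  then have "c = (u * a) * (u' * d)" using u by (metis mult.assoc mult.left_commute mult_1)
  then show "u * a dvd c" by simp
qed

locale seed_in_field =
  fixes \<iota> :: "('p::ab_group_add \<Rightarrow>\<^sub>0 int) \<Rightarrow> 'f::field"
    and \<Sigma> :: "('n::finite, 'p, 'f) seed"
  assumes tf: "torsion_free TYPE('p)" and hom: "inj_ring_hom \<iota>" and seed: "is_seed \<iota> \<Sigma>"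
begin

abbreviation x where "x \<equiv> cluster \<Sigma>"
abbreviation x' where "x' \<equiv> new_var \<iota> \<Sigma>"
abbreviation B where "B \<equiv> exchange_matrix \<Sigma>"
abbreviation mon where "mon \<equiv> laurent_monom \<iota> x"
abbreviation laurent where "laurent \<equiv> eval_at mon"

definition exp_pos where "exp_pos j = (coeff_pos \<Sigma> j, \<lambda>i. max (B i j) 0)"
definition exp_neg where "exp_neg j = (coeff_neg \<Sigma> j, \<lambda>i. max (- B i j) 0)"
definition P where "P j = monom_of (exp_pos j) + monom_of (exp_neg j)"

lemma x_nonzero: "x i \<noteq> 0"
  by (rule cluster_nonzero[OF hom seed])

lemma mon_add: "mon (g + h) = mon g * mon h"
  by (rule laurent_monom_add[OF hom x_nonzero])

lemma mon_zero [simp]: "mon 0 = 1"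
  by (rule laurent_monom_zero[OF hom])

lemma laurent_mult: "laurent (c * d) = laurent c * laurent d"
  by (rule eval_at_mult[OF mon_add])

lemma laurent_one [simp]: "laurent 1 = 1"
  using eval_at_single[of mon 0 1] by simp

lemma laurent_power: "laurent (c ^ n) = laurent c ^ n"
  by (induction n) (simp_all add: laurent_mult)

lemma laurent_prod: "laurent (prod f I) = (\<Prod>i\<in>I. laurent (f i))"
  by (induction I rule: infinite_finite_induct) (simp_all add: laurent_mult)

lemma laurent_monom_of [simp]: "laurent (monom_of g) = mon g"
  by (simp add: eval_at_single)

lemma laurent_eqD: "laurent c = laurent d \<Longrightarrow> c = d"
proof -
  assume "laurent c = laurent d"
  then have "laurent (c - d) = 0" by (simp add: eval_at_diff)
  moreover have "alg_independent (fraction_field \<iota>) x"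
    using seed by (simp add: is_seed_def transcendence_basis_def)
  ultimately have "c - d = 0" using laurent_eval_eq_0_imp[of \<iota> x "c - d"] hom x_nonzero by blast
  then show "c = d" by simp
qed

lemma laurent_P: "laurent (P j) = exchange_poly \<iota> \<Sigma> j"
proof -
  have "(\<Prod>i | 0 < B i j. x i ^ nat (B i j)) = (\<Prod>i\<in>UNIV. x i powi max (B i j) 0)"
    by (rule prod.mono_neutral_cong_left) (auto simp: power_int_def max_def)
  moreover have "(\<Prod>i | B i j < 0. x i ^ nat (- B i j)) = (\<Prod>i\<in>UNIV. x i powi max (- B i j) 0)"
    by (rule prod.mono_neutral_cong_left) (auto simp: power_int_def max_def)
  ultimately show ?thesis
    by (simp add: P_def eval_at_add exchange_poly_def laurent_monom_def exp_pos_def exp_neg_def)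
qed

lemma P_factor: "P j = monom_of (exp_pos j) * (1 + monom_of (exp_neg j - exp_pos j))"
  by (simp add: P_def distrib_left mult_single)

lemma monom_of_unit: "monom_of g * monom_of (- g) = 1"
  by (simp add: mult_single)

lemma nonzerodiv_P: "nonzerodiv_mod 0 (P j)"
  using nonzerodiv_mod_unit_multiples[OF nonzerodiv_binomial[OF torsion_free_exponents[OF tf]],
      of 1 1 "monom_of (exp_pos j)" "monom_of (- exp_pos j)" "exp_neg j - exp_pos j"]
  by (simp add: P_factor monom_of_unit)

lemma exchange_poly_nonzero: "exchange_poly \<iota> \<Sigma> j \<noteq> 0"
proof
  assume "exchange_poly \<iota> \<Sigma> j = 0"
  then have "laurent (P j) = laurent 0" by (simp add: laurent_P)
  then have "P j = 0" by (rule laurent_eqD)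
  then show False using nonzerodiv_modD[OF nonzerodiv_P, of j 1] by simp
qed

lemma mon_mem:
  assumes R: "is_subring R" "range \<iota> \<subseteq> R"
    and x: "\<And>i. x i \<in> R" "\<And>i. snd g i < 0 \<Longrightarrow> inverse (x i) \<in> R"
  shows "mon g \<in> R"
proof -
  have "x i powi snd g i \<in> R" for i
    using x(1)[of i] x(2)[of i] subring_powi[OF R(1)] by (metis not_less)
  then show ?thesis
    unfolding laurent_monom_def using R by (intro is_subringD(5)[OF R(1)] subring_prod[OF R(1)]) auto
qed

text \<open>The exponent vectors of the two terms have disjoint supports, so each is \<open>\<bar>k\<bar>\<close> times the positive or the
  negative part of the exponent vector of \<open>s\<close>. The sign of \<open>k\<close> decides which term is which, and the
  exponent \<open>n\<close> is \<open>\<bar>k\<bar>\<close>. The factor \<open>v + w\<close> of the right-hand side depends on \<open>s\<close> only.\<close>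

lemma P_odd_multiple:
  assumes s: "exp_neg j - exp_pos j = zmul k s" and k: "odd k"
  defines "v \<equiv> monom_of (0, \<lambda>i. max (- snd s i) 0)" and "w \<equiv> monom_of (fst s, \<lambda>i. max (snd s i) 0)"
  obtains p n where "odd n" "P j = monom_of (p, 0) * (v ^ n + w ^ n)"
proof -
  have B: "B i j = - (k * snd s i)" for i
  proof -
    have "snd (exp_neg j - exp_pos j) i = - B i j" by (simp add: exp_pos_def exp_neg_def)
    then show ?thesis using s by (simp add: snd_zmul_apply)
  qed
  have p: "coeff_neg \<Sigma> j = coeff_pos \<Sigma> j + zmul k (fst s)"
    using arg_cong[OF s, of fst]
    by (simp add: exp_pos_def exp_neg_def fst_zmul diff_eq_eq add.commute)
  have max: "max (int n * a) 0 = int n * max a 0" "max (- (int n * a)) 0 = int n * max (- a) 0"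
    for n :: nat and a :: int
    by (auto simp: max_def mult_le_0_iff zero_le_mult_iff)
  show ?thesis
  proof (cases "k > 0")
    case True
    define n where "n = nat k"
    have n: "k = int n" using True by (simp add: n_def)
    have "exp_pos j = (coeff_pos \<Sigma> j, 0) + zmul (int n) (0, \<lambda>i. max (- snd s i) 0)"
      using B max[of n] by (auto simp: exp_pos_def prod_eq_iff fst_zmul snd_zmul_apply n fun_eq_iff)
    moreover have "exp_neg j = (coeff_pos \<Sigma> j, 0) + zmul (int n) (fst s, \<lambda>i. max (snd s i) 0)"
      using B max[of n] p by (auto simp: exp_neg_def prod_eq_iff fst_zmul snd_zmul_apply n fun_eq_iff)
    ultimately have "P j = monom_of (coeff_pos \<Sigma> j, 0) * (v ^ n + w ^ n)"
      by (simp add: P_def v_def w_def monom_of_power mult_single distrib_left)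
    then show ?thesis using that[of n] k n by simp
  next
    case False
    define n where "n = nat (- k)"
    have n: "k = - int n" using False by (simp add: n_def)
    have "exp_pos j = (coeff_neg \<Sigma> j, 0) + zmul (int n) (fst s, \<lambda>i. max (snd s i) 0)"
      using B max[of n] p by (auto simp: exp_pos_def prod_eq_iff fst_zmul snd_zmul_apply n fun_eq_iff
          zmul_minus)
    moreover have "exp_neg j = (coeff_neg \<Sigma> j, 0) + zmul (int n) (0, \<lambda>i. max (- snd s i) 0)"
      using B max[of n] by (auto simp: exp_neg_def prod_eq_iff fst_zmul snd_zmul_apply n fun_eq_iff)
    ultimately have "P j = monom_of (coeff_neg \<Sigma> j, 0) * (v ^ n + w ^ n)"
      by (simp add: P_def v_def w_def monom_of_power mult_single distrib_left add.commute)
    then show ?thesis using that[of n] k n by simp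
  qed
qed

text \<open>Coprimality of the seed is a statement about common divisors in the polynomial ring, whereas the
  proof needs cancellation among Laurent polynomials. In general the two notions are linked by unique
  factorization; for binomials the only obstruction to cancellation is an explicit common
  divisor \<open>v + w\<close>, which, as a sum of two monomials, is not an element of the group up to sign.\<close>

lemma nonzerodiv_mod_P:
  assumes cop: "coprime_seed \<iota> \<Sigma>" and "i \<noteq> j"
  shows "nonzerodiv_mod (P i) (P j)"
  using torsion_free_exponents[OF tf]
proof (cases rule: binomials_coprime_or_odd_multiples[where t = "exp_neg i - exp_pos i"
      and t' = "exp_neg j - exp_pos j"])
  case coprime
  then show ?thesis
    unfolding P_factor by (rule nonzerodiv_mod_unit_multiples[OF _ monom_of_unit monom_of_unit])
next
  case (odd s k l)
  let ?R = "ring_adjoin (range \<iota>) (range x)"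
  note R = is_subring_ring_adjoin[of "range \<iota>" "range x"]
  let ?v = "(0, \<lambda>i. max (- snd s i) 0)" and ?w = "(fst s, \<lambda>i. max (snd s i) 0)"
  have mem: "mon g \<in> ?R" if "\<And>i. 0 \<le> snd g i" for g
    using that by (intro mon_mem R) (auto intro: ring_adjoin_base ring_adjoin_gen simp: not_less[symmetric])
  have vw: "mon ?v \<in> ?R" "mon ?w \<in> ?R" by (rule mem, simp)+
  have dvd: "dvd_in ?R (mon ?v + mon ?w) (exchange_poly \<iota> \<Sigma> j)"
    if s: "exp_neg j - exp_pos j = zmul k s" "odd k" for j k
  proof -
    obtain p n where n: "odd n"
      and P: "P j = monom_of (p, 0) * (monom_of ?v ^ n + monom_of ?w ^ n)"
      by (rule P_odd_multiple[OF s])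
    obtain q where q: "q \<in> ?R" "mon ?v ^ n + mon ?w ^ n = (mon ?v + mon ?w) * q"
      using odd_sum_powers_factor[OF R vw n] by blast
    have "exchange_poly \<iota> \<Sigma> j = mon (p, 0) * (mon ?v ^ n + mon ?w ^ n)"
      by (simp add: P laurent_mult eval_at_add laurent_power flip: laurent_P)
    also have "\<dots> = (mon ?v + mon ?w) * (mon (p, 0) * q)" by (simp add: q(2))
    finally show ?thesis
      unfolding dvd_in_def using vw q(1) mem[of "(p, 0)"] is_subringD(4,5)[OF R] by auto
  qed
  have "dvd_in ?R (mon ?v + mon ?w) (exchange_poly \<iota> \<Sigma> i)"
    "dvd_in ?R (mon ?v + mon ?w) (exchange_poly \<iota> \<Sigma> j)"
    using dvd odd by blast+
  then obtain p where "mon ?v + mon ?w = \<iota> (monom_of p) \<or> mon ?v + mon ?w = - \<iota> (monom_of p)"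
    using cop \<open>i \<noteq> j\<close> unfolding coprime_seed_def Let_def by blast
  moreover have "laurent (monom_of (p, 0)) = \<iota> (monom_of p)"
    by (simp add: laurent_monom_def)
  ultimately have "laurent (monom_of ?v + monom_of ?w) = laurent (monom_of (p, 0))
      \<or> laurent (monom_of ?v + monom_of ?w) = laurent (- monom_of (p, 0))"
    by (simp add: eval_at_add eval_at_minus del: laurent_monom_of) (simp add: laurent_monom_def)
  then show ?thesis using laurent_eqD sum_of_monomials_not_unit by blast
qed


section \<open>Freezing cluster variables\<close>

text \<open>The lower bound of the seed in which only the indices in \<open>S\<close> are mutable: the cluster
  variables outside \<open>S\<close> are made invertible instead.\<close>

definition partial_lower where
  "partial_lower S = ring_adjoin (range \<iota>) (range x \<union> (x' ` S \<union> (\<lambda>k. inverse (x k)) ` (- S)))"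

lemma is_subring_partial_lower: "is_subring (partial_lower S)"
  unfolding partial_lower_def by (rule is_subring_ring_adjoin)

lemma partial_lower_gens:
  "\<iota> r \<in> partial_lower S" "x i \<in> partial_lower S" "i \<in> S \<Longrightarrow> x' i \<in> partial_lower S"
  "i \<notin> S \<Longrightarrow> inverse (x i) \<in> partial_lower S"
  unfolding partial_lower_def by (auto intro: ring_adjoin_base ring_adjoin_gen)

lemma mon_mem_partial_lower:
  assumes "\<And>k. k \<in> S \<Longrightarrow> 0 \<le> snd g k"
  shows "mon g \<in> partial_lower S"
proof (rule mon_mem[OF is_subring_partial_lower])
  show "inverse (x i) \<in> partial_lower S" if "snd g i < 0" for i
    using assms[of i] that by (intro partial_lower_gens) auto
qed (auto intro: partial_lower_gens)

text \<open>Freezing \<open>i\<close> trades \<open>x' i\<close> for the inverse of \<open>x i\<close>, and only finitely many inverses occur in a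
  given element: the lower bound with \<open>i\<close> frozen is contained in the localization at \<open>x i\<close>.\<close>

lemma x_power_clears_freezing:
  assumes "i \<in> S" "u \<in> partial_lower (S - {i})"
  obtains n where "x i ^ n * u \<in> partial_lower S"
proof -
  let ?L = "partial_lower S"
  note L = is_subring_partial_lower[of S]
  let ?T = "{u. \<exists>n. x i ^ n * u \<in> ?L}"
  have pow: "x i ^ n \<in> ?L" for n by (rule subring_power[OF L partial_lower_gens(2)])
  have "is_subring ?T"
    unfolding is_subring_def
  proof (intro conjI ballI)
    show "0 \<in> ?T" "1 \<in> ?T" using is_subringD(1,2)[OF L] by (auto intro: exI[of _ 0])
    show "- a \<in> ?T" if "a \<in> ?T" for a
      using that is_subringD(3)[OF L] by fastforce
    fix a b assume "a \<in> ?T" "b \<in> ?T"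
    then obtain m n where m: "x i ^ m * a \<in> ?L" and n: "x i ^ n * b \<in> ?L" by blast
    have "x i ^ (m + n) * (a + b) = x i ^ n * (x i ^ m * a) + x i ^ m * (x i ^ n * b)"
      by (simp add: power_add algebra_simps)
    also have "\<dots> \<in> ?L" by (intro is_subringD(4,5)[OF L] pow m n)
    finally show "a + b \<in> ?T" by blast
    have "x i ^ (m + n) * (a * b) = (x i ^ m * a) * (x i ^ n * b)"
      by (simp add: power_add algebra_simps)
    also have "\<dots> \<in> ?L" by (intro is_subringD(5)[OF L] m n)
    finally show "a * b \<in> ?T" by blast
  qed
  moreover have "u \<in> ?T" if "u \<in> ?L" for u
    using that by (auto intro: exI[of _ 0])
  moreover have "inverse (x k) \<in> ?T" if "k \<notin> S - {i}" for k
  proof (cases "k = i")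
    case True
    then have "x i ^ 1 * inverse (x k) = 1" using x_nonzero by simp
    then show ?thesis using is_subringD(2)[OF L] by (metis (mono_tags, lifting) mem_Collect_eq)
  next
    case False
    then have "inverse (x k) \<in> ?L" using that by (intro partial_lower_gens) auto
    then show ?thesis by (auto intro: exI[of _ 0])
  qed
  ultimately have "partial_lower (S - {i}) \<subseteq> ?T"
    unfolding partial_lower_def[of "S - {i}"]
    by (intro ring_adjoin_least) (auto intro: partial_lower_gens)
  then show ?thesis using assms(2) that by blast
qed

text \<open>At a source \<open>i\<close> of the graph on \<open>S\<close> one of the two terms of the exchange polynomial contains
  frozen variables only and so is a unit, whereas the other is divisible by \<open>x j\<close>. The exchange
  relation therefore makes \<open>x i\<close> and \<open>x j\<close> comaximal.\<close>

lemma comaximal_at_source: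
  assumes ij: "i \<in> S" "j \<in> S" "B i j > 0" and source: "\<And>k. k \<in> S \<Longrightarrow> B k i \<le> 0"
  obtains c d where "c \<in> partial_lower S" "d \<in> partial_lower S" "c * x i + d * x j = 1"
proof -
  let ?L = "partial_lower S"
  note L = is_subring_partial_lower[of S]
  have "B j i < 0"
    using seed ij(3) unfolding is_seed_def sign_skew_symmetric_def
    by (metis less_numeral_extra(3) mult_less_0_iff not_less_iff_gr_or_eq)
  \<comment> \<open>The second term of the exchange polynomial with one factor \<open>x j\<close> removed.\<close>
  define h where "h = exp_neg i - (0, unit_vec j 1)"
  have unit: "mon (- exp_pos i) * mon (exp_pos i) = 1" by (simp flip: mon_add)
  have h: "mon (exp_neg i) = mon h * x j"
    using mon_add[of h "(0, unit_vec j 1)"] laurent_monom_unit_vec[OF hom, of x j 1]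
    by (simp add: h_def)
  have rel: "x i * x' i = mon (exp_pos i) + mon (exp_neg i)"
    using exchange_relation[OF hom seed, of i] by (simp add: P_def eval_at_add flip: laurent_P)
  have "mon (- exp_pos i) * x' i * x i + - (mon (- exp_pos i) * mon h) * x j
      = mon (- exp_pos i) * (x i * x' i - mon h * x j)"
    by (simp add: algebra_simps)
  also have "\<dots> = 1" by (simp add: rel h unit)
  finally have "mon (- exp_pos i) * x' i * x i + - (mon (- exp_pos i) * mon h) * x j = 1" .
  moreover have "mon (- exp_pos i) \<in> ?L"
    using source by (intro mon_mem_partial_lower) (simp add: exp_pos_def)
  moreover have "mon h \<in> ?L"
    using \<open>B j i < 0\<close> by (intro mon_mem_partial_lower) (auto simp: h_def exp_neg_def)
  ultimately show ?thesis
    using that is_subringD(3,5)[OF L] partial_lower_gens(3)[OF ij(1)] by blast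
qed

text \<open>Among the vertices of \<open>S\<close> that have an edge into \<open>S\<close>, a minimal one has no edge from \<open>S\<close>, because
  the origin of such an edge would be smaller.\<close>

lemma source_exists:
  assumes acyc: "acyclic_seed \<Sigma>" and edge: "a \<in> S" "b \<in> S" "B a b \<noteq> 0"
  obtains i j where "i \<in> S" "j \<in> S" "B i j > 0" "\<And>k. k \<in> S \<Longrightarrow> B k i \<le> 0"
proof -
  let ?r = "{(i, j). i \<in> S \<and> j \<in> S \<and> B i j > 0}"
  have "B a b * B b a < 0"
    using seed edge(3) unfolding is_seed_def sign_skew_symmetric_def by metis
  then have "0 < B a b \<or> 0 < B b a" by (auto simp: mult_less_0_iff)
  then obtain i0 where i0: "i0 \<in> Domain ?r" using edge by auto
  have "finite ?r" by (rule finite_subset[OF subset_UNIV]) simp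
  moreover have "acyclic ?r"
    using acyc unfolding acyclic_seed_def by (rule acyclic_subset) auto
  ultimately have "wf ?r" by (rule finite_acyclic_wf)
  then obtain i where "i \<in> Domain ?r" and min: "\<And>k. (k, i) \<in> ?r \<Longrightarrow> k \<notin> Domain ?r"
    using i0 by (rule wfE_min) blast
  then obtain j where "i \<in> S" "j \<in> S" "B i j > 0" by auto
  moreover have "B k i \<le> 0" if "k \<in> S" for k
  proof (rule ccontr)
    assume "\<not> B k i \<le> 0"
    then have "(k, i) \<in> ?r" using that \<open>i \<in> S\<close> by simp
    then show False using min by (blast intro: DomainI)
  qed
  ultimately show ?thesis by (rule that)
qed

section \<open>Mutable variables without edges between them\<close>

lemma adjacent_mon:
  "laurent_monom \<iota> (adjacent_cluster \<iota> \<Sigma> j) (p, m)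
    = exchange_poly \<iota> \<Sigma> j powi m j * mon (p, m(j := - m j))"
proof -
  let ?y = "adjacent_cluster \<iota> \<Sigma> j"
  have "(\<Prod>i\<in>UNIV. ?y i powi m i) = (x' j powi m j) * (\<Prod>i\<in>UNIV - {j}. x i powi m i)"
    by (simp add: prod.remove[of UNIV j] adjacent_cluster_def)
  moreover have "(\<Prod>i\<in>UNIV. x i powi (m(j := - m j)) i)
      = (x j powi (- m j)) * (\<Prod>i\<in>UNIV - {j}. x i powi m i)"
    by (simp add: prod.remove[of UNIV j])
  moreover have "x' j powi m j = exchange_poly \<iota> \<Sigma> j powi m j * x j powi (- m j)"
    by (simp add: new_var_def divide_inverse power_int_mult_distrib power_int_minus power_int_inverse)
  ultimately show ?thesis by (simp add: laurent_monom_def)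
qed

lemma adjacent_cluster_nonzero: "adjacent_cluster \<iota> \<Sigma> j i \<noteq> 0"
  using x_nonzero exchange_poly_nonzero by (simp add: adjacent_cluster_def new_var_def)

text \<open>In terms of the variables \<open>x\<close> the power \<open>x' j ^ r\<close> becomes \<open>P j ^ r\<close> times \<open>x j\<close> to the
  power \<open>- r\<close>. Negative powers of \<open>x' j\<close> would put \<open>P j\<close> into denominators, so everything is
  multiplied by a high power \<open>P j ^ N\<close>, which is cancelled at the end.\<close>

lemma adjacent_laurent_imp_dvd_part:
  assumes f: "laurent f \<in> laurent_ring \<iota> (adjacent_cluster \<iota> \<Sigma> j)"
    and C: "\<And>f. part C (P j * f) = P j * part C f" "\<And>g. g \<in> C \<Longrightarrow> snd g j = - int r"
  shows "P j ^ r dvd part C f"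
proof -
  obtain d where d: "laurent f = eval_at (laurent_monom \<iota> (adjacent_cluster \<iota> \<Sigma> j)) d"
    using f laurent_ring_subset_eval[OF hom, of "adjacent_cluster \<iota> \<Sigma> j"]
      adjacent_cluster_nonzero by blast
  let ?K = "Poly_Mapping.keys d" and ?d = "Poly_Mapping.lookup d"
  let ?refl = "\<lambda>k. (fst k, (snd k)(j := - snd k j))"
  define N where "N = nat (\<Sum>k\<in>?K. \<bar>snd k j\<bar>)"
  have N: "0 \<le> int N + snd k j" if "k \<in> ?K" for k
  proof -
    have "\<bar>snd k j\<bar> \<le> (\<Sum>k\<in>?K. \<bar>snd k j\<bar>)" using that by (intro member_le_sum) auto
    then show ?thesis by (simp add: N_def)
  qed
  define t where "t k = P j ^ nat (int N + snd k j) * monom_of (?refl k)" for k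
  have "laurent (P j ^ N * f) = (\<Sum>k\<in>?K. of_int (?d k) * laurent (t k))"
  proof -
    have "exchange_poly \<iota> \<Sigma> j ^ N * laurent_monom \<iota> (adjacent_cluster \<iota> \<Sigma> j) k = laurent (t k)"
      if "k \<in> ?K" for k
    proof -
      have "exchange_poly \<iota> \<Sigma> j ^ N * exchange_poly \<iota> \<Sigma> j powi snd k j
          = exchange_poly \<iota> \<Sigma> j ^ nat (int N + snd k j)"
        using exchange_poly_nonzero[of j] N[OF that]
          power_int_add[of "exchange_poly \<iota> \<Sigma> j" "int N" "snd k j"]
        by (simp add: power_int_def[of _ "int N + snd k j"])
      then show ?thesis
        using adjacent_mon[of j "fst k" "snd k"]
        by (simp add: t_def laurent_mult laurent_power laurent_P)
    qed
    then show ?thesis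
      by (simp add: d eval_at_def[of _ d] laurent_mult laurent_power laurent_P sum_distrib_left
          mult.left_commute)
  qed
  also have "\<dots> = laurent (\<Sum>k\<in>?K. Poly_Mapping.single 0 (?d k) * t k)"
    by (simp add: eval_at_sum laurent_mult eval_at_single)
  finally have eq: "P j ^ N * f = (\<Sum>k\<in>?K. Poly_Mapping.single 0 (?d k) * t k)"
    by (rule laurent_eqD)
  have "P j ^ N * part C f = part C (P j ^ N * f)"
    by (rule part_commutes_power[OF C(1), symmetric])
  also have "\<dots> = (\<Sum>k\<in>?K. Poly_Mapping.single 0 (?d k) * part C (t k))"
    unfolding eq part_sum by (intro sum.cong part_mult) (auto split: if_splits)
  finally have eq': "P j ^ N * part C f = (\<Sum>k\<in>?K. Poly_Mapping.single 0 (?d k) * part C (t k))" .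
  have "P j ^ N * P j ^ r dvd P j ^ N * part C f"
    unfolding eq'
  proof (intro dvd_sum dvd_mult)
    fix k assume "k \<in> ?K"
    show "P j ^ N * P j ^ r dvd part C (t k)"
    proof (cases "?refl k \<in> C")
      case True
      then have "nat (int N + snd k j) = N + r" using C(2)[OF True] by simp
      then have "part C (t k) = P j ^ (N + r) * part C (monom_of (?refl k))"
        unfolding t_def by (simp only: part_commutes_power[OF C(1)])
      then show ?thesis by (simp add: power_add)
    next
      case False
      then show ?thesis using part_commutes_power[OF C(1)] by (simp add: t_def part_monom_of)
    qed
  qed
  moreover have "nonzerodiv_mod 0 (P j ^ N)" by (rule nonzerodiv_mod_power[OF nonzerodiv_P])
  ultimately show ?thesis using nonzerodiv_dvd_cancel by blast
qed

text \<open>Without edges inside \<open>S\<close>, the polynomials \<open>P j\<close> with \<open>j \<in> S\<close> involve frozen variables only and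
  respect the grading of Laurent polynomials by the exponents of the variables in \<open>S\<close>. The component
  of degree \<open>v\<close> is divisible by \<open>P j ^ (- v j)\<close> for each \<open>j\<close> with \<open>v j < 0\<close>, hence, by coprimality, by
  the product of these powers. This product times a monomial of degree \<open>v\<close> is, up to frozen
  variables and a coefficient, a product of powers of the \<open>x' j\<close> with \<open>v j < 0\<close> and of the \<open>x j\<close> with
  \<open>v j \<ge> 0\<close>.\<close>

lemma isolated_upper_subset_lower:
  assumes cop: "coprime_seed \<iota> \<Sigma>" and iso: "\<And>i j. i \<in> S \<Longrightarrow> j \<in> S \<Longrightarrow> B i j = 0"
    and u: "u \<in> laurent_ring \<iota> x" "\<And>j. j \<in> S \<Longrightarrow> u \<in> laurent_ring \<iota> (adjacent_cluster \<iota> \<Sigma> j)"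
  shows "u \<in> partial_lower S"
proof -
  let ?L = "partial_lower S"
  note L = is_subring_partial_lower[of S]
  obtain f where f: "u = laurent f"
    using u(1) laurent_ring_subset_eval[OF hom, of x] x_nonzero by blast
  define \<phi> :: "'p \<times> ('n \<Rightarrow> int) \<Rightarrow> 'n \<Rightarrow> int" where "\<phi> g i = (if i \<in> S then snd g i else 0)" for g i
  have "laurent (part {g. \<phi> g = v} f) \<in> ?L" for v
  proof -
    let ?C = "{g. \<phi> g = v}"
    define D where "D = (\<Prod>j\<in>S. P j ^ nat (- v j))"
    have keys_P: "snd g i = 0" if "g \<in> Poly_Mapping.keys (P j)" "j \<in> S" "i \<in> S" for g i j
    proof -
      have "g = exp_pos j \<or> g = exp_neg j"
        using that(1) keys_add[of "monom_of (exp_pos j)" "monom_of (exp_neg j)"]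
        by (auto simp: P_def)
      then show ?thesis using iso[OF that(3,2)] by (auto simp: exp_pos_def exp_neg_def)
    qed
    have P_part: "part ?C (P j * h) = P j * part ?C h" if "j \<in> S" for j h
    proof (rule part_mult)
      fix g k assume "g \<in> Poly_Mapping.keys (P j)"
      then have "\<phi> (g + k) = \<phi> k" using keys_P[OF _ that] by (auto simp: \<phi>_def fun_eq_iff)
      then show "g + k \<in> ?C \<longleftrightarrow> k \<in> ?C" by simp
    qed
    have D_part: "part ?C (D * h) = D * part ?C h" for h
      unfolding D_def by (intro part_commutes_prod part_commutes_power P_part)
    \<comment> \<open>\<open>nat\<close> truncates, so indices with \<open>v j \<ge> 0\<close> contribute the trivial factor to \<open>D\<close>.\<close>
    have "D dvd part ?C f"
      unfolding D_def
    proof (rule prod_dvd_if_pairwise_nonzerodiv_mod)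
      fix i j :: 'n assume "i \<noteq> j"
      then show "nonzerodiv_mod (P i ^ nat (- v i)) (P j ^ nat (- v j))"
        by (intro nonzerodiv_mod_powers nonzerodiv_P nonzerodiv_mod_P[OF cop])
    next
      fix j assume j: "j \<in> S"
      show "P j ^ nat (- v j) dvd part ?C f"
      proof (cases "v j < 0")
        case True
        show ?thesis
        proof (rule adjacent_laurent_imp_dvd_part)
          show "laurent f \<in> laurent_ring \<iota> (adjacent_cluster \<iota> \<Sigma> j)" using u(2)[OF j] f by simp
          show "part ?C (P j * h) = P j * part ?C h" for h by (rule P_part[OF j])
          show "snd g j = - int (nat (- v j))" if "g \<in> ?C" for g
            using that j True by (auto simp: \<phi>_def)
        qed
      qed simp
    qed simp
    then obtain q where "part ?C f = D * q" ..
    \<comment> \<open>The cofactor may be taken homogeneous of degree \<open>v\<close> as well.\<close>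
    then have "part ?C (part ?C f) = D * part ?C q" by (simp add: D_part)
    moreover have "part ?C (part ?C f) = part ?C f" by (rule part_idem) (auto simp: keys_part)
    ultimately have eq: "part ?C f = D * part ?C q" by simp
    have "laurent D * mon k \<in> ?L" if k: "\<phi> k = v" for k
    proof -
      let ?e = "\<lambda>j. exchange_poly \<iota> \<Sigma> j"
      have "mon k = \<iota> (monom_of (fst k)) * (\<Prod>i\<in>S. x i powi snd k i) * (\<Prod>i\<in>-S. x i powi snd k i)"
        by (simp add: laurent_monom_def mult.assoc prod.union_disjoint[symmetric] Compl_partition)
      then have split: "laurent D * mon k = \<iota> (monom_of (fst k)) * (\<Prod>i\<in>-S. x i powi snd k i)
          * (\<Prod>i\<in>S. ?e i ^ nat (- v i) * x i powi snd k i)"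
        by (simp add: D_def laurent_prod laurent_power laurent_P prod.distrib ac_simps)
      have frozen: "(\<Prod>i\<in>-S. x i powi snd k i) \<in> ?L"
      proof (rule subring_prod[OF L])
        fix i assume "i \<in> - S"
        then show "x i powi snd k i \<in> ?L"
          by (intro subring_powi[OF L]) (auto intro: partial_lower_gens)
      qed
      have "(\<Prod>i\<in>S. ?e i ^ nat (- v i) * x i powi snd k i) \<in> ?L"
      proof (rule subring_prod[OF L])
        fix i assume i: "i \<in> S"
        have vi: "snd k i = v i" using k i by (auto simp: \<phi>_def)
        show "?e i ^ nat (- v i) * x i powi snd k i \<in> ?L"
        proof (cases "v i < 0")
          case True
          then have "?e i ^ nat (- v i) * x i powi snd k i = x' i ^ nat (- v i)"
            by (simp add: vi power_int_def new_var_def divide_inverse power_mult_distrib power_inverse)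
          then show ?thesis using i by (simp add: subring_power[OF L] partial_lower_gens)
        next
          case False
          then show ?thesis
            using subring_powi[OF L partial_lower_gens(2), of "v i" i] by (simp add: vi)
        qed
      qed
      then show ?thesis
        unfolding split
        by (rule is_subringD(5)[OF L is_subringD(5)[OF L partial_lower_gens(1) frozen]])
    qed
    then have "(\<Sum>k\<in>Poly_Mapping.keys (part ?C q).
        of_int (Poly_Mapping.lookup (part ?C q) k) * (laurent D * mon k)) \<in> ?L"
      by (intro subring_sum[OF L] is_subringD(5)[OF L subring_of_int[OF L]]) (simp add: keys_part)
    then show ?thesis
      by (simp add: eq laurent_mult eval_at_def[of mon "part ?C q"] sum_distrib_left mult.left_commute)
  qed
  then have "(\<Sum>v\<in>\<phi> ` Poly_Mapping.keys f. laurent (part {g. \<phi> g = v} f)) \<in> ?L"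
    by (intro subring_sum[OF L])
  then show ?thesis by (simp add: f sum_parts flip: eval_at_sum)
qed

section \<open>Comparison of the bounds\<close>

text \<open>As long as \<open>S\<close> contains an edge, freeze either \<open>i\<close> or \<open>j\<close>, where \<open>i\<close> is a source with an edge to
  \<open>j\<close>. The element lies in the frozen lower bounds by induction, and these glue because \<open>x i\<close> and \<open>x j\<close>
  are comaximal.\<close>

lemma upper_subset_partial_lower:
  assumes cop: "coprime_seed \<iota> \<Sigma>" and acyc: "acyclic_seed \<Sigma>"
    and "u \<in> laurent_ring \<iota> x" "\<And>j. j \<in> S \<Longrightarrow> u \<in> laurent_ring \<iota> (adjacent_cluster \<iota> \<Sigma> j)"
  shows "u \<in> partial_lower S"
  using finite[of S] assms(3,4)
proof (induction S rule: finite_psubset_induct)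
  case (psubset S)
  show ?case
  proof (cases "\<forall>i\<in>S. \<forall>j\<in>S. B i j = 0")
    case True
    then show ?thesis by (intro isolated_upper_subset_lower[OF cop _ psubset.prems]) auto
  next
    case False
    then obtain i j where ij: "i \<in> S" "j \<in> S" "B i j > 0" "\<And>k. k \<in> S \<Longrightarrow> B k i \<le> 0"
      using source_exists[OF acyc] by metis
    then obtain c d where cd: "c \<in> partial_lower S" "d \<in> partial_lower S" "c * x i + d * x j = 1"
      by (rule comaximal_at_source)
    have "u \<in> partial_lower (S - {k})" if "k \<in> S" for k
      using psubset.prems that by (intro psubset.IH) auto
    then obtain m n where "x i ^ m * u \<in> partial_lower S" "x j ^ n * u \<in> partial_lower S"
      using x_power_clears_freezing ij(1,2) by metis
    then show ?thesis
      by (rule mem_subring_if_comaximal_multiples[OF is_subring_partial_lower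
          partial_lower_gens(2) partial_lower_gens(2) cd])
  qed
qed

lemma lower_bound_eq_partial_lower: "lower_bound \<iota> \<Sigma> = partial_lower UNIV"
  by (simp add: lower_bound_def partial_lower_def)

lemma exchange_poly_mem:
  assumes R: "is_subring R" "range \<iota> \<subseteq> R" and x: "\<And>i. i \<noteq> j \<Longrightarrow> x i \<in> R"
  shows "exchange_poly \<iota> \<Sigma> j \<in> R"
proof -
  have "B j j = 0"
    using seed unfolding is_seed_def sign_skew_symmetric_def by (metis mult_less_0_iff not_less_iff_gr_or_eq)
  then have "x i \<in> R" if "B i j \<noteq> 0" for i using x that by metis
  then show ?thesis
    unfolding exchange_poly_def using R
    by (intro is_subringD(4,5)[OF R(1)] subring_prod[OF R(1)] subring_power[OF R(1)]) auto
qed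

text \<open>For \<open>i \<noteq> j\<close> the element \<open>x' i\<close> is a polynomial in the variables \<open>x\<close> divided by \<open>x i\<close>; and the only
  variable that the adjacent cluster at \<open>j\<close> lacks is \<open>x j\<close>, the quotient of \<open>P j\<close>, which does not
  involve \<open>x j\<close>, by \<open>x' j\<close>.\<close>

lemma lower_subset_upper: "lower_bound \<iota> \<Sigma> \<subseteq> upper_bound \<iota> \<Sigma>"
  unfolding upper_bound_def
proof (intro Int_greatest INT_greatest)
  have R: "is_subring (laurent_ring \<iota> y)" "range \<iota> \<subseteq> laurent_ring \<iota> y" "y i \<in> laurent_ring \<iota> y"
    "inverse (y i) \<in> laurent_ring \<iota> y" for y :: "'n \<Rightarrow> 'f" and i
    unfolding laurent_ring_def
    by (auto intro: is_subring_ring_adjoin ring_adjoin_base ring_adjoin_gen)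
  show "lower_bound \<iota> \<Sigma> \<subseteq> laurent_ring \<iota> x"
    unfolding lower_bound_def
  proof (rule ring_adjoin_least[OF R(2) _ R(1)])
    show "range x \<union> range x' \<subseteq> laurent_ring \<iota> x"
      by (auto simp: new_var_def divide_inverse intro!: R is_subringD(5)[OF R(1)] exchange_poly_mem)
  qed
  fix j
  let ?y = "adjacent_cluster \<iota> \<Sigma> j"
  have y: "?y j = x' j" "\<And>i. i \<noteq> j \<Longrightarrow> ?y i = x i" by (simp_all add: adjacent_cluster_def)
  have x: "x i \<in> laurent_ring \<iota> ?y" if "i \<noteq> j" for i
    using R(3)[where y = ?y and i = i] y(2)[OF that] by simp
  have "x j = exchange_poly \<iota> \<Sigma> j * inverse (x' j)"
    using exchange_poly_nonzero[of j] by (simp add: new_var_def)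
  then have "x j \<in> laurent_ring \<iota> ?y"
    using R(4)[where y = ?y and i = j] y(1) x
    by (metis exchange_poly_mem[OF R(1,2)] is_subringD(5)[OF R(1)])
  with x have x: "x i \<in> laurent_ring \<iota> ?y" for i by (cases "i = j") auto
  have "x' i \<in> laurent_ring \<iota> ?y" for i
  proof (cases "i = j")
    case True
    then show ?thesis using R(3)[where y = ?y and i = j] y(1) by simp
  next
    case False
    then have "inverse (x i) \<in> laurent_ring \<iota> ?y"
      using R(4)[where y = ?y and i = i] y(2) by simp
    then show ?thesis
      unfolding new_var_def divide_inverse using x
      by (intro is_subringD(5)[OF R(1)] exchange_poly_mem R)
  qed
  with x show "lower_bound \<iota> \<Sigma> \<subseteq> laurent_ring \<iota> ?y"
    unfolding lower_bound_def by (intro ring_adjoin_least R) auto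
qed

end

theorem theorem1p18:
  fixes \<iota> :: "('p::ab_group_add \<Rightarrow>\<^sub>0 int) \<Rightarrow> 'f::field"
    and \<Sigma> :: "('n::finite, 'p, 'f) seed"
  assumes "torsion_free TYPE('p)"
    and "ambient_field TYPE('n) \<iota>"
    and "is_seed \<iota> \<Sigma>"
    and "coprime_seed \<iota> \<Sigma>"
    and "acyclic_seed \<Sigma>"
  shows "lower_bound \<iota> \<Sigma> = upper_bound \<iota> \<Sigma>"
proof -
  interpret seed_in_field \<iota> \<Sigma>
    using assms(1-3) by unfold_locales (auto simp: ambient_field_def)
  show ?thesis
  proof
    show "lower_bound \<iota> \<Sigma> \<subseteq> upper_bound \<iota> \<Sigma>" by (rule lower_subset_upper)
    show "upper_bound \<iota> \<Sigma> \<subseteq> lower_bound \<iota> \<Sigma>"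
      using upper_subset_partial_lower[OF assms(4,5), of _ UNIV]
      unfolding lower_bound_eq_partial_lower upper_bound_def by blast
  qed
qed

end
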